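(* Let $\xi$ be a global (i.e. defined on the whole sphere) covariantly normal unit vector field on the unit sphere $S^{n+1}$. Then $\xi$ is totally geodesic if and only if $n=2m$ for some integer $m$ and $\xi$ is a Hopf vector field.
   Context: $\nabla$ is the Levi-Civita connection of the standard round metric $\langle\cdot,\cdot\rangle$ on the unit sphere. For a unit vector field $\xi$ put $A_\xi X=-\nabla_X\xi$, and let $A_\xi^t$ be the adjoint of $A_\xi$ (viewed as an endomorphism of the tangent space) with respect to the metric, i.e. $\langle A_\xi X,Y\rangle=\langle X,A_\xi^tY\rangle$. A (smooth) unit vector field $\xi$ is covariantly normal if $A_\xi^tA_\xi=A_\xi A_\xi^t$ (as matrices with respect to an orthonormal frame). Sasaki metric: at $Q=(q,\xi)\in TM$, each $X\in T_qM$ has a horizontal lift $X^h$ and a vertical lift $X^v$ in $T_QTM$ (with respect to $\nabla$); the Sasaki metric on $TM$ is determined by $\langle\langle X^h,Y^h\rangle\rangle=\langle X,Y\rangle$, $\langle\langle X^h,Y^v\rangle\rangle=0$, $\langle\langle X^v,Y^v\rangle\rangle=\langle X,Y\rangle$. The unit tangent bundle $T_1M$ carries the induced metric. A unit vector field $\xi$ on $M$ is totally geodesic if the image of the imbedding $\xi:M\to T_1M$, $q\mapsto(q,\xi(q))$, is a totally geodesic submanifold of $T_1M$ with the Sasaki metric. A Hopf vector field on $S^{2m+1}\subset\mathbb R^{2m+2}$ is a unit vector field of the form $\xi(x)=Jx$, where $J$ is an orthogonal complex structure on $\mathbb R^{2m+2}$ ($J$ orthogonal, $J^2=-\mathrm{Id}$);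 it is the unit tangent field of the fibres of a Hopf fibration. *)

theory Defs
  imports "HOL-Analysis.Analysis"
begin

section \<open>Smooth maps and tangent spaces of subsets of Euclidean space\<close>

text \<open>
  All manifolds are embedded submanifolds of a Euclidean space and are represented by their
  carrier sets.  Functions and vector fields on \<open>M\<close> are functions on the ambient space of which
  only the values at the points of \<open>M\<close> matter.
\<close>

primrec higher_differentiable_on ::
  "'a::real_normed_vector set \<Rightarrow> ('a \<Rightarrow> 'b::real_normed_vector) \<Rightarrow> nat \<Rightarrow> bool" where
  "higher_differentiable_on U f 0 \<longleftrightarrow> continuous_on U f"
| "higher_differentiable_on U f (Suc k) \<longleftrightarrow>
     (\<forall>x\<in>U. f differentiable (at x)) \<and>
     (\<forall>v. higher_differentiable_on U (\<lambda>x. frechet_derivative f (at x) v) k)"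

text \<open>\<open>C\<^sup>\<infinity>\<close> on an open set \<open>U\<close>.\<close>

definition smooth_on ::
  "'a::real_normed_vector set \<Rightarrow> ('a \<Rightarrow> 'b::real_normed_vector) \<Rightarrow> bool" where
  "smooth_on U f \<longleftrightarrow> (\<forall>k. higher_differentiable_on U f k)"

text \<open>Smoothness on an arbitrary subset \<open>M\<close>: local extendability to a smooth function.\<close>

definition smooth_map_on ::
  "'a::real_normed_vector set \<Rightarrow> ('a \<Rightarrow> 'b::real_normed_vector) \<Rightarrow> bool" where
  "smooth_map_on M f \<longleftrightarrow>
     (\<forall>p\<in>M. \<exists>U F. open U \<and> p \<in> U \<and> smooth_on U F \<and> (\<forall>x\<in>U \<inter> M. F x = f x))"

definition tangent_space :: "'a::real_normed_vector set \<Rightarrow> 'a \<Rightarrow> 'a set" where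
  "tangent_space M p =
     {v. \<exists>e>0. \<exists>c::real \<Rightarrow> 'a. smooth_on {-e<..<e} c \<and> c ` {-e<..<e} \<subseteq> M \<and> c 0 = p \<and>
           (c has_vector_derivative v) (at 0)}"

definition smooth_vector_field :: "'a::real_normed_vector set \<Rightarrow> ('a \<Rightarrow> 'a) \<Rightarrow> bool" where
  "smooth_vector_field M X \<longleftrightarrow> smooth_map_on M X \<and> (\<forall>p\<in>M. X p \<in> tangent_space M p)"

text \<open>
  Differential of a smooth \<open>f\<close> on \<open>M\<close>.  The derivative within \<open>M\<close> is not unique as a linear map
  on the ambient space, but by the chain rule along curves in \<open>M\<close> its values on
  \<open>tangent_space M p\<close> are; it is only ever applied to tangent vectors.
\<close>

definition diff_on ::
  "'a::real_normed_vector set \<Rightarrow> ('a \<Rightarrow> 'b::real_normed_vector) \<Rightarrow> 'a \<Rightarrow> 'a \<Rightarrow> 'b" where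
  "diff_on M f p v = frechet_derivative f (at p within M) v"

definition lie_bracket_on ::
  "'a::real_normed_vector set \<Rightarrow> ('a \<Rightarrow> 'a) \<Rightarrow> ('a \<Rightarrow> 'a) \<Rightarrow> 'a \<Rightarrow> 'a" where
  "lie_bracket_on M X Y p = diff_on M Y p (X p) - diff_on M X p (Y p)"


section \<open>Levi-Civita connections and totally geodesic submanifolds\<close>

text \<open>
  A Riemannian metric on \<open>M\<close> is a function \<open>g\<close> with \<open>g p u v\<close> the product of
  \<open>u, v \<in> tangent_space M p\<close>; \<open>D X Y\<close> stands for the field \<open>\<nabla>\<^sub>X Y\<close>.
\<close>

definition affine_connection ::
  "'a::real_normed_vector set \<Rightarrow> (('a \<Rightarrow> 'a) \<Rightarrow> ('a \<Rightarrow> 'a) \<Rightarrow> ('a \<Rightarrow> 'a)) \<Rightarrow> bool" where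
  "affine_connection M D \<longleftrightarrow>
     (\<forall>X Y. smooth_vector_field M X \<longrightarrow> smooth_vector_field M Y \<longrightarrow>
        smooth_vector_field M (D X Y)) \<and>
     (\<forall>X X' Y. smooth_vector_field M X \<longrightarrow> smooth_vector_field M X' \<longrightarrow>
        smooth_vector_field M Y \<longrightarrow>
        (\<forall>p\<in>M. D (\<lambda>x. X x + X' x) Y p = D X Y p + D X' Y p)) \<and>
     (\<forall>f X Y. smooth_map_on M (f :: 'a \<Rightarrow> real) \<longrightarrow> smooth_vector_field M X \<longrightarrow>
        smooth_vector_field M Y \<longrightarrow>
        (\<forall>p\<in>M. D (\<lambda>x. f x *\<^sub>R X x) Y p = f p *\<^sub>R D X Y p)) \<and>
     (\<forall>X Y Y'. smooth_vector_field M X \<longrightarrow> smooth_vector_field M Y \<longrightarrow>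
        smooth_vector_field M Y' \<longrightarrow>
        (\<forall>p\<in>M. D X (\<lambda>x. Y x + Y' x) p = D X Y p + D X Y' p)) \<and>
     (\<forall>f X Y. smooth_map_on M (f :: 'a \<Rightarrow> real) \<longrightarrow> smooth_vector_field M X \<longrightarrow>
        smooth_vector_field M Y \<longrightarrow>
        (\<forall>p\<in>M. D X (\<lambda>x. f x *\<^sub>R Y x) p = diff_on M f p (X p) *\<^sub>R Y p + f p *\<^sub>R D X Y p))"

definition levi_civita ::
  "'a::real_normed_vector set \<Rightarrow> ('a \<Rightarrow> 'a \<Rightarrow> 'a \<Rightarrow> real) \<Rightarrow>
     (('a \<Rightarrow> 'a) \<Rightarrow> ('a \<Rightarrow> 'a) \<Rightarrow> ('a \<Rightarrow> 'a)) \<Rightarrow> bool" where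
  "levi_civita M g D \<longleftrightarrow>
     affine_connection M D \<and>
     (\<forall>X Y. smooth_vector_field M X \<longrightarrow> smooth_vector_field M Y \<longrightarrow>
        (\<forall>p\<in>M. D X Y p - D Y X p = lie_bracket_on M X Y p)) \<and>
     (\<forall>X Y Z. smooth_vector_field M X \<longrightarrow> smooth_vector_field M Y \<longrightarrow>
        smooth_vector_field M Z \<longrightarrow>
        (\<forall>p\<in>M. diff_on M (\<lambda>x. g x (Y x) (Z x)) p (X p) =
                 g p (D X Y p) (Z p) + g p (Y p) (D X Z p)))"

text \<open>
  The submanifold \<open>N\<close> of \<open>(M, g)\<close> has vanishing second fundamental form: for vector fields
  tangent to \<open>N\<close> along \<open>N\<close>, the Levi-Civita derivative in \<open>M\<close> is tangent to \<open>N\<close> along \<open>N\<close>.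
  By the fundamental theorem of Riemannian geometry \<open>D\<close> exists, and its values on \<open>M\<close> are unique.
\<close>

definition totally_geodesic_submanifold ::
  "'a::real_normed_vector set \<Rightarrow> ('a \<Rightarrow> 'a \<Rightarrow> 'a \<Rightarrow> real) \<Rightarrow> 'a set \<Rightarrow> bool" where
  "totally_geodesic_submanifold M g N \<longleftrightarrow>
     N \<subseteq> M \<and>
     (\<exists>D. levi_civita M g D \<and>
        (\<forall>X Y. smooth_vector_field M X \<longrightarrow> smooth_vector_field M Y \<longrightarrow>
           (\<forall>p\<in>N. X p \<in> tangent_space N p) \<longrightarrow> (\<forall>p\<in>N. Y p \<in> tangent_space N p) \<longrightarrow>
           (\<forall>p\<in>N. D X Y p \<in> tangent_space N p)))"


section \<open>The round unit sphere\<close>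

abbreviation unit_sphere :: "'a::euclidean_space set" where
  "unit_sphere \<equiv> sphere 0 1"

definition tangential :: "'a::euclidean_space \<Rightarrow> 'a \<Rightarrow> 'a" where
  "tangential q w = w - (w \<bullet> q) *\<^sub>R q"

text \<open>
  \<open>cov_deriv Y q u\<close> is \<open>\<nabla>\<^sub>u Y\<close> at \<open>q\<close>, the tangential part of the Euclidean derivative;
  lemma \<open>levi_civita_cov_deriv\<close> below shows that this is the Levi-Civita connection of the
  round metric.
\<close>

definition cov_deriv :: "('a::euclidean_space \<Rightarrow> 'a) \<Rightarrow> 'a \<Rightarrow> 'a \<Rightarrow> 'a" where
  "cov_deriv Y q u = tangential q (diff_on unit_sphere Y q u)"

definition unit_vector_field :: "('a::euclidean_space \<Rightarrow> 'a) \<Rightarrow> bool" where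
  "unit_vector_field \<xi> \<longleftrightarrow>
     smooth_vector_field unit_sphere \<xi> \<and> (\<forall>q\<in>unit_sphere. norm (\<xi> q) = 1)"

definition shape_operator :: "('a::euclidean_space \<Rightarrow> 'a) \<Rightarrow> 'a \<Rightarrow> 'a \<Rightarrow> 'a" where
  "shape_operator \<xi> q X = - cov_deriv \<xi> q X"

text \<open>\<open>B\<close> is the adjoint of the endomorphism \<open>A\<close> of the subspace \<open>V\<close>.\<close>

definition is_adjoint_on ::
  "'a::euclidean_space set \<Rightarrow> ('a \<Rightarrow> 'a) \<Rightarrow> ('a \<Rightarrow> 'a) \<Rightarrow> bool" where
  "is_adjoint_on V A B \<longleftrightarrow>
     (\<forall>X\<in>V. B X \<in> V) \<and> (\<forall>X\<in>V. \<forall>Y\<in>V. A X \<bullet> Y = X \<bullet> B Y)"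

definition covariantly_normal :: "('a::euclidean_space \<Rightarrow> 'a) \<Rightarrow> bool" where
  "covariantly_normal \<xi> \<longleftrightarrow>
     (\<forall>q\<in>unit_sphere.
        \<exists>B. is_adjoint_on (tangent_space unit_sphere q) (shape_operator \<xi> q) B \<and>
            (\<forall>X\<in>tangent_space unit_sphere q.
               B (shape_operator \<xi> q X) = shape_operator \<xi> q (B X)))"


subsection \<open>Consistency of the definitions\<close>

lemma higher_differentiable_on_cong:
  assumes "open U" "\<And>x. x \<in> U \<Longrightarrow> f x = g x"
  shows "higher_differentiable_on U f k \<longleftrightarrow> higher_differentiable_on U g k"
  using assms(2)
proof (induction k arbitrary: f g)
  case 0
  then show ?case by (simp cong: continuous_on_cong)
next
  case (Suc k)
  have d: "(f has_derivative L) (at x) \<longleftrightarrow> (g has_derivative L) (at x)" if "x \<in> U" for x L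
    using Suc.prems that assms(1)
    by (metis has_derivative_transform_within_open)
  have "f differentiable at x \<longleftrightarrow> g differentiable at x" if "x \<in> U" for x
    using d[OF that] by (simp add: differentiable_def)
  moreover have "frechet_derivative f (at x) = frechet_derivative g (at x)" if "x \<in> U" for x
    using d[OF that] by (simp add: frechet_derivative_def)
  then have "higher_differentiable_on U (\<lambda>x. frechet_derivative f (at x) v) k \<longleftrightarrow>
      higher_differentiable_on U (\<lambda>x. frechet_derivative g (at x) v) k" for v
    by (intro Suc.IH) simp
  ultimately show ?case by simp
qed

lemma higher_differentiable_on_Suc_imp:
  "higher_differentiable_on U f (Suc k) \<Longrightarrow> higher_differentiable_on U f k"
proof (induction k arbitrary: f)
  case 0
  then show ?case
    by (auto intro!: continuous_at_imp_continuous_on differentiable_imp_continuous_within)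
next
  case (Suc k)
  from Suc.prems have d: "\<forall>x\<in>U. f differentiable (at x)"
    and "\<And>v. higher_differentiable_on U (\<lambda>x. frechet_derivative f (at x) v) (Suc k)"
    by (auto simp only: higher_differentiable_on.simps)
  then have "\<And>v. higher_differentiable_on U (\<lambda>x. frechet_derivative f (at x) v) k"
    by (intro Suc.IH)
  with d show ?case by simp
qed

lemma higher_differentiable_on_subset:
  "higher_differentiable_on U f k \<Longrightarrow> V \<subseteq> U \<Longrightarrow> higher_differentiable_on V f k"
  by (induction k arbitrary: f) (auto intro: continuous_on_subset)

lemma higher_differentiable_on_const: "higher_differentiable_on U (\<lambda>x. c) k"
  by (induction k arbitrary: c) (auto simp: frechet_derivative_const)

lemma higher_differentiable_on_bounded_linear:
  assumes "bounded_linear L" "open U" "higher_differentiable_on U f k"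
  shows "higher_differentiable_on U (\<lambda>x. L (f x)) k"
  using assms(3)
proof (induction k arbitrary: f)
  case 0
  then show ?case by (simp add: bounded_linear.continuous_on[OF assms(1)])
next
  case (Suc k)
  have d: "((\<lambda>x. L (f x)) has_derivative (\<lambda>v. L (frechet_derivative f (at x) v))) (at x)"
    if "x \<in> U" for x
    by (rule bounded_linear.has_derivative[OF assms(1)])
      (use Suc.prems that in \<open>simp add: frechet_derivative_works[symmetric]\<close>)
  have "higher_differentiable_on U (\<lambda>x. frechet_derivative (\<lambda>x. L (f x)) (at x) v) k" for v
  proof -
    have "higher_differentiable_on U (\<lambda>x. L (frechet_derivative f (at x) v)) k"
      using Suc by simp
    then show ?thesis
      by (subst higher_differentiable_on_cong
          [OF assms(2), where g = "\<lambda>x. L (frechet_derivative f (at x) v)"])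
        (simp_all add: frechet_derivative_at[OF d, symmetric])
  qed
  then show ?case using d by (auto simp: differentiable_def)
qed

lemma higher_differentiable_on_add:
  assumes "open U" "higher_differentiable_on U f k" "higher_differentiable_on U g k"
  shows "higher_differentiable_on U (\<lambda>x. f x + g x) k"
  using assms(2,3)
proof (induction k arbitrary: f g)
  case 0
  then show ?case by (simp add: continuous_on_add)
next
  case (Suc k)
  have d: "((\<lambda>x. f x + g x) has_derivative
      (\<lambda>v. frechet_derivative f (at x) v + frechet_derivative g (at x) v)) (at x)"
    if "x \<in> U" for x
    by (rule has_derivative_add)
      (use Suc.prems that in \<open>simp_all add: frechet_derivative_works[symmetric]\<close>)
  have "higher_differentiable_on U (\<lambda>x. frechet_derivative (\<lambda>x. f x + g x) (at x) v) k" for v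
  proof -
    have "higher_differentiable_on U
        (\<lambda>x. frechet_derivative f (at x) v + frechet_derivative g (at x) v) k"
      using Suc by simp
    then show ?thesis
      by (subst higher_differentiable_on_cong[OF assms(1), where
            g = "\<lambda>x. frechet_derivative f (at x) v + frechet_derivative g (at x) v"])
        (simp_all add: frechet_derivative_at[OF d, symmetric])
  qed
  then show ?case using d by (auto simp: differentiable_def)
qed

lemma higher_differentiable_on_bilinear:
  assumes "bounded_bilinear B" "open U"
    "higher_differentiable_on U f k" "higher_differentiable_on U g k"
  shows "higher_differentiable_on U (\<lambda>x. B (f x) (g x)) k"
  using assms(3,4)
proof (induction k arbitrary: f g)
  case 0
  then show ?case by (simp add: bounded_bilinear.continuous_on[OF assms(1)])
next
  case (Suc k)
  let ?d = "\<lambda>x v. B (f x) (frechet_derivative g (at x) v) + B (frechet_derivative f (at x) v) (g x)"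
  have d: "((\<lambda>x. B (f x) (g x)) has_derivative ?d x) (at x)" if "x \<in> U" for x
    by (rule bounded_bilinear.FDERIV[OF assms(1)])
      (use Suc.prems that in \<open>simp_all add: frechet_derivative_works[symmetric]\<close>)
  have "higher_differentiable_on U (\<lambda>x. frechet_derivative (\<lambda>x. B (f x) (g x)) (at x) v) k" for v
  proof -
    have "higher_differentiable_on U (\<lambda>x. ?d x v) k"
      using Suc.prems Suc.prems[THEN higher_differentiable_on_Suc_imp]
      by (intro higher_differentiable_on_add assms Suc.IH) auto
    then show ?thesis
      by (subst higher_differentiable_on_cong[OF assms(2), where g = "\<lambda>x. ?d x v"])
        (simp_all add: frechet_derivative_at[OF d, symmetric])
  qed
  then show ?case using d by (auto simp: differentiable_def)
qed

lemma smooth_map_onE: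
  assumes "smooth_map_on M f" "p \<in> M"
  obtains U F where "open U" "p \<in> U" "smooth_on U F" "\<And>x. x \<in> U \<Longrightarrow> x \<in> M \<Longrightarrow> F x = f x"
  using assms unfolding smooth_map_on_def by (metis IntI)

lemma smooth_map_on_bilinear:
  assumes B: "bounded_bilinear B" and "smooth_map_on M f" "smooth_map_on M g"
  shows "smooth_map_on M (\<lambda>x. B (f x) (g x))"
  unfolding smooth_map_on_def
proof
  fix p assume p: "p \<in> M"
  obtain U F where 1: "open U" "p \<in> U" "smooth_on U F" "\<And>x. x \<in> U \<Longrightarrow> x \<in> M \<Longrightarrow> F x = f x"
    using smooth_map_onE[OF assms(2) p] by blast
  obtain V G where 2: "open V" "p \<in> V" "smooth_on V G" "\<And>x. x \<in> V \<Longrightarrow> x \<in> M \<Longrightarrow> G x = g x"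
    using smooth_map_onE[OF assms(3) p] by blast
  have "smooth_on (U \<inter> V) (\<lambda>x. B (F x) (G x))"
    using 1 2 unfolding smooth_on_def
    by (auto intro!: higher_differentiable_on_bilinear[OF B] intro: higher_differentiable_on_subset)
  then show "\<exists>U F. open U \<and> p \<in> U \<and> smooth_on U F \<and> (\<forall>x\<in>U \<inter> M. F x = B (f x) (g x))"
    using 1 2 by (intro exI[of _ "U \<inter> V"] exI[of _ "\<lambda>x. B (F x) (G x)"]) auto
qed

lemma smooth_map_on_add:
  assumes "smooth_map_on M f" "smooth_map_on M g"
  shows "smooth_map_on M (\<lambda>x. f x + g x)"
  unfolding smooth_map_on_def
proof
  fix p assume p: "p \<in> M"
  obtain U F where 1: "open U" "p \<in> U" "smooth_on U F" "\<And>x. x \<in> U \<Longrightarrow> x \<in> M \<Longrightarrow> F x = f x"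
    using smooth_map_onE[OF assms(1) p] by blast
  obtain V G where 2: "open V" "p \<in> V" "smooth_on V G" "\<And>x. x \<in> V \<Longrightarrow> x \<in> M \<Longrightarrow> G x = g x"
    using smooth_map_onE[OF assms(2) p] by blast
  have "smooth_on (U \<inter> V) (\<lambda>x. F x + G x)"
    using 1 2 unfolding smooth_on_def
    by (auto intro!: higher_differentiable_on_add intro: higher_differentiable_on_subset)
  then show "\<exists>U F. open U \<and> p \<in> U \<and> smooth_on U F \<and> (\<forall>x\<in>U \<inter> M. F x = f x + g x)"
    using 1 2 by (intro exI[of _ "U \<inter> V"] exI[of _ "\<lambda>x. F x + G x"]) auto
qed

lemma smooth_map_on_const: "smooth_map_on (M :: 'a::real_normed_vector set) (\<lambda>x. c)"
proof -
  have "smooth_on UNIV (\<lambda>x::'a. c)"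
    by (simp add: smooth_on_def higher_differentiable_on_const)
  then show ?thesis
    unfolding smooth_map_on_def by (intro ballI exI[of _ UNIV] exI conjI) auto
qed

lemma smooth_map_on_ident: "smooth_map_on (M :: 'a::real_normed_vector set) (\<lambda>x. x)"
proof -
  have "higher_differentiable_on UNIV (\<lambda>x::'a. x) k" for k
    by (cases k) (auto simp: frechet_derivative_ident higher_differentiable_on_const)
  then have "smooth_on UNIV (\<lambda>x::'a. x)"
    by (simp add: smooth_on_def)
  then show ?thesis
    unfolding smooth_map_on_def by (intro ballI exI[of _ UNIV] exI conjI) auto
qed

lemma smooth_on_imp_has_derivative:
  assumes "smooth_on U F" "x \<in> U"
  shows "(F has_derivative frechet_derivative F (at x)) (at x)"
  using assms(1)[unfolded smooth_on_def, rule_format, of "Suc 0"] assms(2)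
  by (simp add: frechet_derivative_works)

lemma smooth_on_frechet_derivative:
  assumes "smooth_on U F"
  shows "smooth_on U (\<lambda>x. frechet_derivative F (at x) v)"
  unfolding smooth_on_def
proof
  fix k
  show "higher_differentiable_on U (\<lambda>x. frechet_derivative F (at x) v) k"
    using assms[unfolded smooth_on_def, rule_format, of "Suc k"] by simp
qed

lemma has_derivative_transfer_within:
  assumes "open U" "p \<in> U" "p \<in> M" "(F has_derivative L) (at p)"
    "\<And>x. x \<in> U \<Longrightarrow> x \<in> M \<Longrightarrow> F x = f x"
  shows "(f has_derivative L) (at p within M)"
proof -
  obtain e where "e > 0" "ball p e \<subseteq> U" using assms openE by blast
  then show ?thesis
    using assms
    by (intro has_derivative_transform_within[OF has_derivative_at_withinI[OF assms(4)], of e])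
      (auto simp: dist_commute subset_iff)
qed

lemma diff_on_eqI:
  assumes L: "(f has_derivative L) (at p within M)" and v: "v \<in> tangent_space M p"
  shows "diff_on M f p v = L v"
proof -
  obtain e c where e: "e > 0" and c: "c ` {-e<..<e} \<subseteq> M" "c 0 = p" "(c has_vector_derivative v) (at 0)"
    using v unfolding tangent_space_def by blast
  have *: "((\<lambda>t. f (c t)) has_vector_derivative L' v) (at 0)"
    if L': "(f has_derivative L') (at p within M)" for L'
  proof -
    have "(c has_derivative (\<lambda>t. t *\<^sub>R v)) (at 0 within {-e<..<e})"
      using c(3) unfolding has_vector_derivative_def by (rule has_derivative_at_withinI)
    moreover have "(f has_derivative L') (at (c 0) within c ` {-e<..<e})"
      using L' c by (auto intro: has_derivative_subset)
    ultimately have "(f \<circ> c has_derivative L' \<circ> (\<lambda>t. t *\<^sub>R v)) (at 0 within {-e<..<e})"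
      by (rule diff_chain_within)
    moreover have "at 0 within {-e<..<e} = at (0::real)"
      using e by (intro at_within_open) auto
    moreover have "linear L'" using L' has_derivative_linear by blast
    ultimately show ?thesis
      by (simp add: has_vector_derivative_def o_def linear_scale)
  qed
  have "(f has_derivative frechet_derivative f (at p within M)) (at p within M)"
    using L frechet_derivative_works differentiable_def by blast
  from *[OF this] *[OF L] show ?thesis
    unfolding diff_on_def by (metis vector_derivative_unique_at)
qed

lemma smooth_map_on_has_derivative:
  assumes "smooth_map_on M f" "p \<in> M"
  shows "(f has_derivative diff_on M f p) (at p within M)"
proof -
  obtain U F where 1: "open U" "p \<in> U" "smooth_on U F" "\<And>x. x \<in> U \<Longrightarrow> x \<in> M \<Longrightarrow> F x = f x"
    using smooth_map_onE[OF assms] by blast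
  have "(f has_derivative frechet_derivative F (at p)) (at p within M)"
    using has_derivative_transfer_within[OF 1(1,2) assms(2) smooth_on_imp_has_derivative[OF 1(3,2)]] 1(4)
    by blast
  then show ?thesis
    unfolding diff_on_def by (metis differentiable_def frechet_derivative_works)
qed

lemma smooth_map_on_diff_on:
  fixes f :: "'a::euclidean_space \<Rightarrow> 'b::real_normed_vector"
  assumes "smooth_map_on M f" "smooth_vector_field M X"
  shows "smooth_map_on M (\<lambda>x. diff_on M f x (X x))"
  unfolding smooth_map_on_def
proof
  fix p assume p: "p \<in> M"
  obtain U F where 1: "open U" "p \<in> U" "smooth_on U F" "\<And>x. x \<in> U \<Longrightarrow> x \<in> M \<Longrightarrow> F x = f x"
    using smooth_map_onE[OF assms(1) p] by blast
  obtain V G where 2: "open V" "p \<in> V" "smooth_on V G" "\<And>x. x \<in> V \<Longrightarrow> x \<in> M \<Longrightarrow> G x = X x"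
    using smooth_map_onE[of M X p] assms(2) p unfolding smooth_vector_field_def by blast
  let ?H = "\<lambda>x. \<Sum>b\<in>Basis. (G x \<bullet> b) *\<^sub>R frechet_derivative F (at x) b"
  have H: "higher_differentiable_on (U \<inter> V) (\<lambda>x. \<Sum>b\<in>A. (G x \<bullet> b) *\<^sub>R frechet_derivative F (at x) b) k"
    if "finite A" for k and A :: "'a set"
    using that
  proof (induction A)
    case (insert b A)
    have G: "higher_differentiable_on (U \<inter> V) G k"
      using 2(3) unfolding smooth_on_def by (auto intro: higher_differentiable_on_subset)
    have F: "higher_differentiable_on (U \<inter> V) (\<lambda>x. frechet_derivative F (at x) b) k"
      using smooth_on_frechet_derivative[OF 1(3)] unfolding smooth_on_def
      by (auto intro: higher_differentiable_on_subset)
    show ?case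
      using insert 1(1) 2(1) F
        higher_differentiable_on_bounded_linear[OF bounded_linear_inner_left _ G]
      by (auto intro!: higher_differentiable_on_add
          higher_differentiable_on_bilinear[OF bounded_bilinear_scaleR])
  qed (simp add: higher_differentiable_on_const)
  have "smooth_on (U \<inter> V) ?H"
    unfolding smooth_on_def by (intro allI H finite_Basis)
  moreover have "?H x = diff_on M f x (X x)" if x: "x \<in> U \<inter> V" "x \<in> M" for x
  proof -
    have d: "(F has_derivative frechet_derivative F (at x)) (at x)"
      using smooth_on_imp_has_derivative 1 x by blast
    then have "(f has_derivative frechet_derivative F (at x)) (at x within M)"
      using has_derivative_transfer_within[of U x M F _ f] 1 x by blast
    then have "diff_on M f x (X x) = frechet_derivative F (at x) (X x)"
      using assms(2) x unfolding smooth_vector_field_def by (intro diff_on_eqI) auto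
    also have "\<dots> = frechet_derivative F (at x) (\<Sum>b\<in>Basis. (X x \<bullet> b) *\<^sub>R b)"
      by (simp add: euclidean_representation)
    also have "\<dots> = ?H x"
      using has_derivative_linear[OF d] 2(4) x
      by (simp add: linear_sum linear_scale)
    finally show ?thesis by simp
  qed
  ultimately show "\<exists>U F. open U \<and> p \<in> U \<and> smooth_on U F \<and> (\<forall>x\<in>U \<inter> M. F x = diff_on M f x (X x))"
    using 1 2 by (intro exI[of _ "U \<inter> V"] exI[of _ ?H]) auto
qed

lemma tangent_space_sphere:
  fixes q :: "'a::euclidean_space"
  assumes q: "q \<in> unit_sphere"
  shows "tangent_space unit_sphere q = {v. v \<bullet> q = 0}"
proof (intro equalityI subsetI)
  fix v assume "v \<in> tangent_space unit_sphere q"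
  then obtain e c where e: "e > 0" and c: "c ` {-e<..<e} \<subseteq> unit_sphere" "c 0 = q"
      "(c has_vector_derivative v) (at 0)"
    unfolding tangent_space_def by blast
  have "((\<lambda>t. c t \<bullet> c t) has_derivative (\<lambda>t. c 0 \<bullet> (t *\<^sub>R v) + (t *\<^sub>R v) \<bullet> c 0)) (at 0)"
    using c(3) unfolding has_vector_derivative_def by (intro has_derivative_inner)
  moreover have "((\<lambda>t. c t \<bullet> c t) has_derivative (\<lambda>t. 0)) (at 0)"
    using has_derivative_const
  proof (rule has_derivative_transform_within_open)
    show "open {-e<..<e}" "0 \<in> {-e<..<e}" using e by auto
    show "1 = c t \<bullet> c t" if "t \<in> {-e<..<e}" for t
      using that c(1) by (auto simp: image_subset_iff dot_square_norm)
  qed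
  ultimately have "(\<lambda>t. c 0 \<bullet> (t *\<^sub>R v) + (t *\<^sub>R v) \<bullet> c 0) = (\<lambda>t. 0)"
    by (rule has_derivative_unique)
  from fun_cong[OF this, of 1] show "v \<in> {v. v \<bullet> q = 0}"
    using c(2) by (simp add: inner_commute)
next
  fix v :: 'a assume "v \<in> {v. v \<bullet> q = 0}"
  then have v: "v \<bullet> q = 0" by simp
  define a where "a = norm v"
  define w where "w = v /\<^sub>R a"
  have aw: "a *\<^sub>R w = v" by (cases "v = 0") (auto simp: a_def w_def)
  have hd: "higher_differentiable_on {-1<..<1} (\<lambda>t. cos (a * t) *\<^sub>R x + sin (a * t) *\<^sub>R y) k"
    for x y :: 'a and k
  proof (induction k arbitrary: x y)
    case 0
    then show ?case by (auto intro!: continuous_intros)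
  next
    case (Suc k)
    have d: "((\<lambda>t. cos (a * t) *\<^sub>R x + sin (a * t) *\<^sub>R y) has_derivative
        (\<lambda>s. cos (a * t) *\<^sub>R (s * a) *\<^sub>R y + sin (a * t) *\<^sub>R - (s * a) *\<^sub>R x)) (at t)" for t
      by (auto intro!: derivative_eq_intros simp: algebra_simps)
    have "higher_differentiable_on {-1<..<1}
        (\<lambda>t. cos (a * t) *\<^sub>R (s * a) *\<^sub>R y + sin (a * t) *\<^sub>R - (s * a) *\<^sub>R x) k" for s
      by (rule Suc)
    moreover have "(\<lambda>t. cos (a * t) *\<^sub>R x + sin (a * t) *\<^sub>R y) differentiable (at t)" for t
      using d differentiable_def by blast
    ultimately show ?case
      unfolding higher_differentiable_on.simps frechet_derivative_at[OF d, symmetric] by blast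
  qed
  let ?c = "\<lambda>t. cos (a * t) *\<^sub>R q + sin (a * t) *\<^sub>R w"
  have "(?c has_vector_derivative v) (at 0)"
    unfolding has_vector_derivative_def
    by (auto intro!: derivative_eq_intros simp: fun_eq_iff aw[symmetric])
  moreover have "norm (?c t) = 1" for t
  proof (cases "a = 0")
    case True
    then show ?thesis using q by simp
  next
    case False
    have "w \<bullet> q = 0" "w \<bullet> w = 1" "q \<bullet> q = 1"
      using v q False by (simp_all add: w_def a_def dot_square_norm power2_eq_square)
    then have "?c t \<bullet> ?c t = (cos (a * t))\<^sup>2 + (sin (a * t))\<^sup>2"
      by (simp add: inner_simps inner_commute power2_eq_square)
    then show ?thesis by (simp add: norm_eq_sqrt_inner)
  qed
  ultimately show "v \<in> tangent_space unit_sphere q"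
    unfolding tangent_space_def smooth_on_def
    using hd by (auto intro!: exI[of _ 1] exI[of _ ?c])
qed

lemma smooth_vector_field_sphere_iff:
  "smooth_vector_field unit_sphere Y \<longleftrightarrow>
     smooth_map_on unit_sphere Y \<and> (\<forall>q\<in>unit_sphere. Y q \<bullet> q = 0)"
  unfolding smooth_vector_field_def using tangent_space_sphere by blast

lemma diff_on_vector_field_sphere:
  assumes Y: "smooth_vector_field unit_sphere Y" and q: "q \<in> unit_sphere" and u: "u \<bullet> q = 0"
  shows "diff_on unit_sphere Y q u \<bullet> q = - (Y q \<bullet> u)"
proof -
  have u': "u \<in> tangent_space unit_sphere q" using tangent_space_sphere[OF q] u by simp
  have "((\<lambda>x. Y x \<bullet> x) has_derivative (\<lambda>h. Y q \<bullet> h + diff_on unit_sphere Y q h \<bullet> q))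
      (at q within unit_sphere)"
    using Y q unfolding smooth_vector_field_def
    by (intro has_derivative_inner smooth_map_on_has_derivative has_derivative_ident) auto
  from diff_on_eqI[OF this u']
  have "diff_on unit_sphere (\<lambda>x. Y x \<bullet> x) q u = Y q \<bullet> u + diff_on unit_sphere Y q u \<bullet> q" .
  moreover have "((\<lambda>x. Y x \<bullet> x) has_derivative (\<lambda>h. 0)) (at q within unit_sphere)"
    by (rule has_derivative_transform[OF q _ has_derivative_const])
      (use Y in \<open>simp add: smooth_vector_field_sphere_iff\<close>)
  from diff_on_eqI[OF this u'] have "diff_on unit_sphere (\<lambda>x. Y x \<bullet> x) q u = 0" .
  ultimately show ?thesis by simp
qed

lemma tangential_inner:
  "norm q = 1 \<Longrightarrow> tangential q w \<bullet> q = 0"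
  "u \<bullet> q = 0 \<Longrightarrow> tangential q w \<bullet> u = w \<bullet> u"
  "u \<bullet> q = 0 \<Longrightarrow> u \<bullet> tangential q w = u \<bullet> w"
  by (simp_all add: tangential_def inner_diff_left inner_diff_right inner_commute dot_square_norm)

theorem levi_civita_cov_deriv:
  "levi_civita unit_sphere (\<lambda>q u v. u \<bullet> v) (\<lambda>X Y q. cov_deriv Y q (X q))"
  unfolding levi_civita_def affine_connection_def
proof (intro conjI allI impI ballI)
  fix X Y :: "'a \<Rightarrow> 'a"
  assume X: "smooth_vector_field unit_sphere X" and Y: "smooth_vector_field unit_sphere Y"
  have Xs: "smooth_map_on unit_sphere X" and Ys: "smooth_map_on unit_sphere Y"
    using X Y by (auto simp: smooth_vector_field_def)
  let ?dY = "\<lambda>q. diff_on unit_sphere Y q (X q)"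
  have "smooth_map_on unit_sphere (\<lambda>q. ?dY q + (- 1) *\<^sub>R ((?dY q \<bullet> q) *\<^sub>R q))"
    by (intro smooth_map_on_add smooth_map_on_bilinear[OF bounded_bilinear_scaleR]
        smooth_map_on_bilinear[OF bounded_bilinear_inner] smooth_map_on_const
        smooth_map_on_ident smooth_map_on_diff_on X Ys)
  then have "smooth_map_on unit_sphere (\<lambda>q. cov_deriv Y q (X q))"
    by (simp add: cov_deriv_def tangential_def)
  then show "smooth_vector_field unit_sphere (\<lambda>q. cov_deriv Y q (X q))"
    by (simp add: smooth_vector_field_sphere_iff cov_deriv_def tangential_inner)
  {
    fix q :: 'a assume q: "q \<in> unit_sphere"
    note dX = smooth_map_on_has_derivative[OF Xs q] and dY = smooth_map_on_has_derivative[OF Ys q]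
    have XT: "X q \<in> tangent_space unit_sphere q" and Xq: "X q \<bullet> q = 0" and Yq: "Y q \<bullet> q = 0"
      using X Y q tangent_space_sphere[OF q]
      by (auto simp: smooth_vector_field_sphere_iff)
    show "cov_deriv Y q (X q) - cov_deriv X q (Y q) = lie_bracket_on unit_sphere X Y q"
      using diff_on_vector_field_sphere[OF X q Yq] diff_on_vector_field_sphere[OF Y q Xq]
      by (simp add: cov_deriv_def tangential_def lie_bracket_on_def inner_commute)
    {
      fix f :: "'a \<Rightarrow> real" assume f: "smooth_map_on unit_sphere f"
      show "cov_deriv Y q (f q *\<^sub>R X q) = f q *\<^sub>R cov_deriv Y q (X q)"
        using has_derivative_linear[OF dY]
        by (simp add: cov_deriv_def tangential_def linear_scale algebra_simps)
      have "((\<lambda>x. f x *\<^sub>R Y x) has_derivative (\<lambda>h. f q *\<^sub>R diff_on unit_sphere Y q h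
          + diff_on unit_sphere f q h *\<^sub>R Y q)) (at q within unit_sphere)"
        by (intro has_derivative_scaleR dY smooth_map_on_has_derivative f q)
      from diff_on_eqI[OF this XT] Yq
      show "cov_deriv (\<lambda>x. f x *\<^sub>R Y x) q (X q) =
          diff_on unit_sphere f q (X q) *\<^sub>R Y q + f q *\<^sub>R cov_deriv Y q (X q)"
        by (simp add: cov_deriv_def tangential_def algebra_simps)
    }
    {
      fix Z :: "'a \<Rightarrow> 'a" assume Z: "smooth_vector_field unit_sphere Z"
      have Zs: "smooth_map_on unit_sphere Z" and Zq: "Z q \<bullet> q = 0"
        using Z q by (auto simp: smooth_vector_field_sphere_iff)
      note dZ = smooth_map_on_has_derivative[OF Zs q]
      show "cov_deriv Z q (X q + Y q) = cov_deriv Z q (X q) + cov_deriv Z q (Y q)"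
        using has_derivative_linear[OF dZ]
        by (simp add: cov_deriv_def tangential_def linear_add algebra_simps)
      show "cov_deriv (\<lambda>x. Y x + Z x) q (X q) = cov_deriv Y q (X q) + cov_deriv Z q (X q)"
        using diff_on_eqI[OF has_derivative_add[OF dY dZ] XT]
        by (simp add: cov_deriv_def tangential_def algebra_simps)
      show "diff_on unit_sphere (\<lambda>x. Y x \<bullet> Z x) q (X q) =
          cov_deriv Y q (X q) \<bullet> Z q + Y q \<bullet> cov_deriv Z q (X q)"
        using diff_on_eqI[OF has_derivative_inner[OF dY dZ] XT] Yq Zq
        by (simp add: cov_deriv_def tangential_inner)
    }
  }
qed


section \<open>The unit tangent bundle with the Sasaki metric\<close>

definition unit_tangent_bundle :: "('a::euclidean_space \<times> 'a) set" where
  "unit_tangent_bundle =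
     {(q, v). q \<in> unit_sphere \<and> v \<in> tangent_space unit_sphere q \<and> norm v = 1}"

text \<open>
  Lifts of \<open>X\<close> to the point \<open>(q, v)\<close> of the tangent bundle
  \<open>{(q, v). norm q = 1 \<and> q \<bullet> v = 0}\<close>.  If \<open>Y\<close> is a vector field with \<open>Y q = v\<close> and
  \<open>\<nabla>\<^sub>X Y = 0\<close> at \<open>q\<close>, then \<open>dY(X)\<close> is a multiple of \<open>q\<close>, and differentiating
  \<open>x \<bullet> Y x = 0\<close> shows that \<open>dY(X) = - (X \<bullet> v) q\<close>; see lemma \<open>horizontal_lift_parallel\<close>.
\<close>

definition horizontal_lift :: "'a::euclidean_space \<times> 'a \<Rightarrow> 'a \<Rightarrow> 'a \<times> 'a" where
  "horizontal_lift Q X = (X, - (X \<bullet> snd Q) *\<^sub>R fst Q)"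

definition vertical_lift :: "'a::euclidean_space \<times> 'a \<Rightarrow> 'a \<Rightarrow> 'a \<times> 'a" where
  "vertical_lift Q X = (0, X)"

text \<open>
  A tangent vector \<open>W\<close> at \<open>(q, v)\<close> is the sum of the horizontal lift of \<open>fst W\<close> and the vertical
  lift of \<open>tangential q (snd W)\<close> (lemma \<open>horizontal_vertical_decomposition\<close>); the Sasaki metric
  declares the two lifts to be orthogonal and isometric.
\<close>

definition sasaki_metric ::
  "'a::euclidean_space \<times> 'a \<Rightarrow> 'a \<times> 'a \<Rightarrow> 'a \<times> 'a \<Rightarrow> real" where
  "sasaki_metric Q W W' =
     fst W \<bullet> fst W' + tangential (fst Q) (snd W) \<bullet> tangential (fst Q) (snd W')"

lemma horizontal_lift_parallel:
  assumes "smooth_vector_field unit_sphere Y" "q \<in> unit_sphere"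
    and "X \<in> tangent_space unit_sphere q" and "cov_deriv Y q X = 0"
  shows "(X, diff_on unit_sphere Y q X) = horizontal_lift (q, Y q) X"
  using assms diff_on_vector_field_sphere[of Y q X] tangent_space_sphere[of q]
  by (simp add: horizontal_lift_def cov_deriv_def tangential_def inner_commute)

lemma tangent_space_unit_tangent_bundle_subset:
  assumes "W \<in> tangent_space unit_tangent_bundle (q, v)"
  shows "fst W \<bullet> q = 0" and "fst W \<bullet> v + q \<bullet> snd W = 0"
proof -
  obtain e c where e: "e > 0" and c: "c ` {-e<..<e} \<subseteq> unit_tangent_bundle" "c 0 = (q, v)"
      "(c has_vector_derivative W) (at 0)"
    using assms unfolding tangent_space_def by blast
  have c': "fst (c t) \<bullet> fst (c t) = 1 \<and> snd (c t) \<bullet> fst (c t) = 0" if "t \<in> {-e<..<e}" for t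
  proof -
    have "c t \<in> unit_tangent_bundle" using c(1) that by blast
    then show ?thesis
      using tangent_space_sphere
      by (fastforce simp: unit_tangent_bundle_def dot_square_norm)
  qed
  have d: "(c has_derivative (\<lambda>t. t *\<^sub>R W)) (at 0)"
    using c(3) by (simp add: has_vector_derivative_def)
  note dd = has_derivative_fst[OF d] has_derivative_snd[OF d]
  have nb: "open {-e<..<e}" "0 \<in> {-e<..<e}" using e by auto
  have "((\<lambda>t. fst (c t) \<bullet> fst (c t)) has_derivative (\<lambda>t. 0)) (at 0)"
    using has_derivative_transform_within_open[OF has_derivative_const nb,
        of 1 "\<lambda>t. fst (c t) \<bullet> fst (c t)"] c' by auto
  from fun_cong[OF has_derivative_unique[OF has_derivative_inner[OF dd(1) dd(1)] this], of 1]
  show "fst W \<bullet> q = 0" by (simp add: c(2) inner_commute)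
  have "((\<lambda>t. snd (c t) \<bullet> fst (c t)) has_derivative (\<lambda>t. 0)) (at 0)"
    using has_derivative_transform_within_open[OF has_derivative_const nb,
        of 0 "\<lambda>t. snd (c t) \<bullet> fst (c t)"] c' by auto
  from fun_cong[OF has_derivative_unique[OF has_derivative_inner[OF dd(2) dd(1)] this], of 1]
  show "fst W \<bullet> v + q \<bullet> snd W = 0" by (simp add: c(2) inner_commute)
qed

lemma horizontal_vertical_decomposition:
  assumes "W \<in> tangent_space unit_tangent_bundle (q, v)"
  shows "W = horizontal_lift (q, v) (fst W) + vertical_lift (q, v) (tangential q (snd W))"
proof -
  have "snd W \<bullet> q = - (fst W \<bullet> v)"
    using tangent_space_unit_tangent_bundle_subset(2)[OF assms] by (simp add: inner_commute)
  then show ?thesis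
    by (simp add: prod_eq_iff horizontal_lift_def vertical_lift_def tangential_def)
qed

lemma sasaki_metric_lifts:
  assumes "q \<in> unit_sphere" "X \<in> tangent_space unit_sphere q" "Y \<in> tangent_space unit_sphere q"
  shows "sasaki_metric (q, v) (horizontal_lift (q, v) X) (horizontal_lift (q, v) Y) = X \<bullet> Y"
    and "sasaki_metric (q, v) (horizontal_lift (q, v) X) (vertical_lift (q, v) Y) = 0"
    and "sasaki_metric (q, v) (vertical_lift (q, v) X) (vertical_lift (q, v) Y) = X \<bullet> Y"
proof -
  have q: "q \<bullet> q = 1" and XY: "X \<bullet> q = 0" "Y \<bullet> q = 0"
    using assms tangent_space_sphere[OF assms(1)] by (auto simp: dot_square_norm)
  have "tangential q (a *\<^sub>R q) = 0" "tangential q X = X" "tangential q Y = Y" for a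
    using q XY by (simp_all add: tangential_def)
  note * = this(1)[of "- a" for a, unfolded scaleR_minus_left] this
  show "sasaki_metric (q, v) (horizontal_lift (q, v) X) (horizontal_lift (q, v) Y) = X \<bullet> Y"
    and "sasaki_metric (q, v) (horizontal_lift (q, v) X) (vertical_lift (q, v) Y) = 0"
    and "sasaki_metric (q, v) (vertical_lift (q, v) X) (vertical_lift (q, v) Y) = X \<bullet> Y"
    by (simp_all add: sasaki_metric_def horizontal_lift_def vertical_lift_def *)
qed

definition totally_geodesic :: "('a::euclidean_space \<Rightarrow> 'a) \<Rightarrow> bool" where
  "totally_geodesic \<xi> \<longleftrightarrow>
     totally_geodesic_submanifold unit_tangent_bundle sasaki_metric
       ((\<lambda>q. (q, \<xi> q)) ` unit_sphere)"

definition hopf_vector_field :: "('a::euclidean_space \<Rightarrow> 'a) \<Rightarrow> bool" where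
  "hopf_vector_field \<xi> \<longleftrightarrow>
     (\<exists>J. orthogonal_transformation J \<and> (\<forall>x. J (J x) = - x) \<and>
          (\<forall>q\<in>unit_sphere. \<xi> q = J q))"

end

theory Submission
  imports Defs
begin

text \<open>
  Write \<open>\<phi> u = \<nabla>\<^sub>u \<xi>\<close>.  The unit tangent bundle is the Stiefel manifold of orthonormal pairs, on
  which the Sasaki metric has an explicit Levi-Civita connection, so that the vanishing of the
  second fundamental form of the graph of \<open>\<xi>\<close> becomes an equation for the second derivative of
  \<open>\<xi>\<close> applied to a pair \<open>(u, w)\<close>.  Covariant normality gives \<open>\<phi> \<xi> = 0\<close>, and for \<open>w = \<xi>\<close> the
  equation then reads \<open>\<phi>\<^sup>2 = -1\<close> on the complement of \<open>\<xi>\<close>.  A normal operator with square \<open>-1\<close>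
  is orthogonal and skew.  With this, the equation for a general \<open>w\<close> says that the linear map of
  the ambient space given by \<open>d\<xi>\<close> on the tangent space and by \<open>q \<mapsto> \<xi> q\<close> on its normal is the
  same at all points \<open>q\<close> of the sphere; it is the required complex structure.
\<close>

section \<open>Smooth maps\<close>

lemma higher_differentiable_on_sum:
  assumes "open U" "finite A" "\<And>b. b \<in> A \<Longrightarrow> higher_differentiable_on U (f b) k"
  shows "higher_differentiable_on U (\<lambda>x. \<Sum>b\<in>A. f b x) k"
  using assms(2,3)
  by (induction A)
    (auto simp: higher_differentiable_on_const intro!: higher_differentiable_on_add assms(1))

text \<open>Induction on the order with the chain rule. The direction in which \<open>f\<close> is
  differentiated varies with \<open>x\<close>, whereas the induction hypothesis concerns derivatives
  in fixed directions; expanding the direction in \<open>Basis\<close> reduces one to the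
  other.\<close>

lemma higher_differentiable_on_compose:
  fixes g :: "'a::real_normed_vector \<Rightarrow> 'b::euclidean_space"
    and f :: "'b \<Rightarrow> 'c::real_normed_vector"
  assumes "open U" "open V" "g ` U \<subseteq> V"
    and "higher_differentiable_on V f k" "higher_differentiable_on U g k"
  shows "higher_differentiable_on U (\<lambda>x. f (g x)) k"
  using assms(4,5)
proof (induction k arbitrary: f)
  case 0
  then show ?case using assms(3) by (auto intro: continuous_on_compose2)
next
  case (Suc k)
  let ?d = "\<lambda>x v. \<Sum>b\<in>Basis. (frechet_derivative g (at x) v \<bullet> b) *\<^sub>R frechet_derivative f (at (g x)) b"
  have d: "((\<lambda>x. f (g x)) has_derivative ?d x) (at x)" if "x \<in> U" for x
  proof -
    have f: "(f has_derivative frechet_derivative f (at (g x))) (at (g x))"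
      and g: "(g has_derivative frechet_derivative g (at x)) (at x)"
      using Suc.prems assms(3) that by (auto simp: frechet_derivative_works[symmetric])
    have "frechet_derivative f (at (g x)) w = (\<Sum>b\<in>Basis. (w \<bullet> b) *\<^sub>R frechet_derivative f (at (g x)) b)"
      for w
    proof -
      have "frechet_derivative f (at (g x)) w
          = frechet_derivative f (at (g x)) (\<Sum>b\<in>Basis. (w \<bullet> b) *\<^sub>R b)"
        by (simp add: euclidean_representation)
      also have "\<dots> = (\<Sum>b\<in>Basis. (w \<bullet> b) *\<^sub>R frechet_derivative f (at (g x)) b)"
        using has_derivative_linear[OF f] by (simp only: linear_sum linear_scale)
      finally show ?thesis .
    qed
    then have "?d x = (\<lambda>v. frechet_derivative f (at (g x)) (frechet_derivative g (at x) v))"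
      by (metis (no_types))
    then show ?thesis
      using has_derivative_compose[OF g f] by simp
  qed
  have "higher_differentiable_on U (\<lambda>x. frechet_derivative (\<lambda>x. f (g x)) (at x) v) k" for v
  proof -
    have "higher_differentiable_on U (\<lambda>x. ?d x v) k"
      using Suc.prems higher_differentiable_on_Suc_imp[OF Suc.prems(2)]
      by (intro higher_differentiable_on_sum assms(1) finite_Basis
          higher_differentiable_on_bilinear[OF bounded_bilinear_scaleR] Suc.IH
          higher_differentiable_on_bounded_linear[OF bounded_linear_inner_left]) auto
    then show ?thesis
      by (subst higher_differentiable_on_cong[OF assms(1), where g = "\<lambda>x. ?d x v"])
        (simp_all add: frechet_derivative_at[OF d, symmetric])
  qed
  then show ?case using d by (auto simp: differentiable_def)
qed

lemma smooth_on_compose: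
  fixes g :: "'a::real_normed_vector \<Rightarrow> 'b::euclidean_space"
  assumes "open U" "open V" "g ` U \<subseteq> V" "smooth_on V f" "smooth_on U g"
  shows "smooth_on U (\<lambda>x. f (g x))"
  using assms unfolding smooth_on_def by (blast intro: higher_differentiable_on_compose)

lemma smooth_on_subset: "smooth_on U f \<Longrightarrow> V \<subseteq> U \<Longrightarrow> smooth_on V f"
  unfolding smooth_on_def by (blast intro: higher_differentiable_on_subset)

lemma smooth_on_imp_continuous_on: "smooth_on U f \<Longrightarrow> continuous_on U f"
  unfolding smooth_on_def by (metis higher_differentiable_on.simps(1))

lemma smooth_map_on_compose:
  fixes g :: "'a::real_normed_vector \<Rightarrow> 'b::euclidean_space"
  assumes "smooth_map_on M f" "smooth_map_on N g" "g ` N \<subseteq> M"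
  shows "smooth_map_on N (\<lambda>x. f (g x))"
  unfolding smooth_map_on_def
proof
  fix p assume p: "p \<in> N"
  obtain U G where 1: "open U" "p \<in> U" "smooth_on U G" "\<And>x. x \<in> U \<Longrightarrow> x \<in> N \<Longrightarrow> G x = g x"
    using smooth_map_onE[OF assms(2) p] by blast
  obtain V F where 2: "open V" "g p \<in> V" "smooth_on V F" "\<And>x. x \<in> V \<Longrightarrow> x \<in> M \<Longrightarrow> F x = f x"
    using smooth_map_onE[OF assms(1), of "g p"] assms(3) p by blast
  have "open (U \<inter> G -` V)"
    using continuous_open_preimage[OF smooth_on_imp_continuous_on] 1 2 by blast
  moreover have "smooth_on (U \<inter> G -` V) (\<lambda>x. F (G x))"
    using calculation 2(1) _ 2(3) smooth_on_subset[OF 1(3)] by (rule smooth_on_compose) auto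
  ultimately show "\<exists>U F. open U \<and> p \<in> U \<and> smooth_on U F \<and> (\<forall>x\<in>U \<inter> N. F x = f (g x))"
    using 1 2 p assms(3)
    by (intro exI[of _ "U \<inter> G -` V"] exI[of _ "\<lambda>x. F (G x)"]) (auto simp: image_subset_iff)
qed

lemma smooth_map_on_bounded_linear:
  assumes L: "bounded_linear L" and "smooth_map_on M f"
  shows "smooth_map_on M (\<lambda>x. L (f x))"
  unfolding smooth_map_on_def
proof
  fix p assume p: "p \<in> M"
  obtain U F where 1: "open U" "p \<in> U" "smooth_on U F" "\<And>x. x \<in> U \<Longrightarrow> x \<in> M \<Longrightarrow> F x = f x"
    using smooth_map_onE[OF assms(2) p] by blast
  have "smooth_on U (\<lambda>x. L (F x))"
    using 1 unfolding smooth_on_def by (auto intro: higher_differentiable_on_bounded_linear[OF L])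
  then show "\<exists>U F. open U \<and> p \<in> U \<and> smooth_on U F \<and> (\<forall>x\<in>U \<inter> M. F x = L (f x))"
    using 1 by (intro exI[of _ U] exI[of _ "\<lambda>x. L (F x)"]) auto
qed

lemma higher_differentiable_on_ident: "higher_differentiable_on U (\<lambda>x. x) k"
  by (cases k) (auto simp: frechet_derivative_ident higher_differentiable_on_const)

lemma smooth_on_const: "smooth_on U (\<lambda>x. c)"
  by (simp add: smooth_on_def higher_differentiable_on_const)

lemma smooth_on_ident: "smooth_on U (\<lambda>x. x)"
  by (simp add: smooth_on_def higher_differentiable_on_ident)

lemma smooth_on_add:
  "open U \<Longrightarrow> smooth_on U f \<Longrightarrow> smooth_on U g \<Longrightarrow> smooth_on U (\<lambda>x. f x + g x)"
  by (simp add: smooth_on_def higher_differentiable_on_add)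

lemma smooth_on_bilinear:
  "bounded_bilinear B \<Longrightarrow> open U \<Longrightarrow> smooth_on U f \<Longrightarrow> smooth_on U g \<Longrightarrow>
    smooth_on U (\<lambda>x. B (f x) (g x))"
  by (simp add: smooth_on_def higher_differentiable_on_bilinear)

lemma smooth_on_bounded_linear:
  "bounded_linear L \<Longrightarrow> open U \<Longrightarrow> smooth_on U f \<Longrightarrow> smooth_on U (\<lambda>x. L (f x))"
  by (simp add: smooth_on_def higher_differentiable_on_bounded_linear)

lemma smooth_on_Pair:
  fixes f :: "'a::real_normed_vector \<Rightarrow> 'b::real_normed_vector"
    and g :: "'a \<Rightarrow> 'c::real_normed_vector"
  assumes "open U" "smooth_on U f" "smooth_on U g"
  shows "smooth_on U (\<lambda>x. (f x, g x))"
proof -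
  have "bounded_linear (\<lambda>x::'b. (x, 0::'c))" "bounded_linear (\<lambda>x::'c. (0::'b, x))"
    by (intro bounded_linear_Pair bounded_linear_zero bounded_linear_ident)+
  from smooth_on_add[OF assms(1) smooth_on_bounded_linear[OF this(1) assms(1,2)]
      smooth_on_bounded_linear[OF this(2) assms(1,3)]]
  show ?thesis by simp
qed

text \<open>With \<open>h = inverse (sqrt f)\<close> the derivative is
  \<open>- 1 / 2 * f' * h^3\<close>, again a product of \<open>f'\<close> and \<open>h\<close>, so
  the induction closes on this single function. It supplies the normalising factors of a
  Gram-Schmidt curve.\<close>

lemma higher_differentiable_on_inverse_sqrt:
  fixes f :: "'a::real_normed_vector \<Rightarrow> real"
  assumes U: "open U" and pos: "\<And>x. x \<in> U \<Longrightarrow> f x > 0" and "higher_differentiable_on U f k"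
  shows "higher_differentiable_on U (\<lambda>x. inverse (sqrt (f x))) k"
  using assms(3)
proof (induction k)
  case 0
  then show ?case using pos by (force intro!: continuous_intros)
next
  case (Suc k)
  let ?h = "\<lambda>x. inverse (sqrt (f x))"
  let ?d = "\<lambda>x v. (- 1 / 2) * (frechet_derivative f (at x) v * (?h x * (?h x * ?h x)))"
  have d: "(?h has_derivative ?d x) (at x)" if x: "x \<in> U" for x
  proof -
    have f: "(f has_derivative frechet_derivative f (at x)) (at x)"
      using Suc.prems x by (simp add: frechet_derivative_works[symmetric])
    show ?thesis
      using pos[OF x]
      by (auto intro!: derivative_eq_intros f simp: fun_eq_iff field_simps)
  qed
  have "higher_differentiable_on U (\<lambda>x. frechet_derivative ?h (at x) v) k" for v
  proof -
    have "higher_differentiable_on U (\<lambda>x. ?d x v) k"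
      using Suc.prems Suc.IH[OF higher_differentiable_on_Suc_imp[OF Suc.prems]]
      by (intro higher_differentiable_on_bilinear[OF bounded_bilinear_mult] U
          higher_differentiable_on_const) auto
    then show ?thesis
      by (subst higher_differentiable_on_cong[OF U, where g = "\<lambda>x. ?d x v"])
        (simp_all add: frechet_derivative_at[OF d, symmetric])
  qed
  then show ?case using d by (auto simp: differentiable_def)
qed

lemma smooth_on_inverse_sqrt:
  fixes f :: "'a::real_normed_vector \<Rightarrow> real"
  assumes "open U" "\<And>x. x \<in> U \<Longrightarrow> f x > 0" "smooth_on U f"
  shows "smooth_on U (\<lambda>x. inverse (sqrt (f x)))"
  using assms by (simp add: smooth_on_def higher_differentiable_on_inverse_sqrt)

lemma smooth_map_on_Pair:
  fixes f :: "'a::real_normed_vector \<Rightarrow> 'b::real_normed_vector"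
    and g :: "'a \<Rightarrow> 'c::real_normed_vector"
  assumes "smooth_map_on M f" "smooth_map_on M g"
  shows "smooth_map_on M (\<lambda>x. (f x, g x))"
proof -
  have "bounded_linear (\<lambda>x::'b. (x, 0::'c))" "bounded_linear (\<lambda>x::'c. (0::'b, x))"
    by (intro bounded_linear_Pair bounded_linear_zero bounded_linear_ident)+
  from smooth_map_on_add[OF smooth_map_on_bounded_linear[OF this(1) assms(1)]
      smooth_map_on_bounded_linear[OF this(2) assms(2)]]
  show ?thesis by simp
qed

lemmas smooth_map_on_fst = smooth_map_on_bounded_linear[OF bounded_linear_fst]
  and smooth_map_on_snd = smooth_map_on_bounded_linear[OF bounded_linear_snd]
  and smooth_map_on_inner = smooth_map_on_bilinear[OF bounded_bilinear_inner]
  and smooth_map_on_scaleR = smooth_map_on_bilinear[OF bounded_bilinear_scaleR]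
  and smooth_map_on_mult =
    smooth_map_on_bilinear[OF bounded_bilinear_mult[where 'a = real]]

lemma smooth_map_on_minus: "smooth_map_on M f \<Longrightarrow> smooth_map_on M (\<lambda>x. - f x)"
  by (rule smooth_map_on_bounded_linear[OF bounded_linear_minus[OF bounded_linear_ident]])

lemma smooth_map_on_diff:
  "smooth_map_on M f \<Longrightarrow> smooth_map_on M g \<Longrightarrow> smooth_map_on M (\<lambda>x. f x - g x)"
  using smooth_map_on_add[OF _ smooth_map_on_minus, of M f g] by simp

lemmas smooth_map_intros = smooth_map_on_const smooth_map_on_ident smooth_map_on_add
  smooth_map_on_diff smooth_map_on_minus smooth_map_on_inner smooth_map_on_scaleR
  smooth_map_on_mult smooth_map_on_fst smooth_map_on_snd smooth_map_on_Pair

section \<open>The Levi-Civita connection of the Sasaki metric\<close>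

lemma unit_tangent_bundle_iff:
  "(q, v) \<in> unit_tangent_bundle \<longleftrightarrow> q \<bullet> q = 1 \<and> v \<bullet> v = 1 \<and> v \<bullet> q = 0"
  using tangent_space_sphere[of q]
  by (auto simp: unit_tangent_bundle_def norm_eq_1)

text \<open>The equations are the linearised orthonormality relations. Differentiating them along a
  curve gives one inclusion; for the other, a curve in the bundle with prescribed velocity is
  constructed.\<close>

lemma tangent_space_unit_tangent_bundle:
  fixes q v :: "'a::euclidean_space"
  assumes Q: "(q, v) \<in> unit_tangent_bundle"
  shows "tangent_space unit_tangent_bundle (q, v) =
    {(X, Z). X \<bullet> q = 0 \<and> X \<bullet> v + Z \<bullet> q = 0 \<and> Z \<bullet> v = 0}"
proof (intro equalityI subsetI)
  fix W assume W: "W \<in> tangent_space unit_tangent_bundle (q, v)"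
  then obtain e c where e: "e > 0" and c: "c ` {-e<..<e} \<subseteq> unit_tangent_bundle" "c 0 = (q, v)"
      "(c has_vector_derivative W) (at 0)"
    unfolding tangent_space_def by blast
  have d: "((\<lambda>t. snd (c t)) has_derivative (\<lambda>t. snd (t *\<^sub>R W))) (at 0)"
    using c(3) unfolding has_vector_derivative_def by (rule has_derivative_snd)
  have "((\<lambda>t. snd (c t) \<bullet> snd (c t)) has_derivative (\<lambda>t. 0)) (at 0)"
    using has_derivative_const
  proof (rule has_derivative_transform_within_open)
    show "open {-e<..<e}" "0 \<in> {-e<..<e}" using e by auto
    show "1 = snd (c t) \<bullet> snd (c t)" if "t \<in> {-e<..<e}" for t
    proof -
      have "(fst (c t), snd (c t)) \<in> unit_tangent_bundle" using that c(1) by auto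
      then show ?thesis by (simp only: unit_tangent_bundle_iff)
    qed
  qed
  from fun_cong[OF has_derivative_unique[OF has_derivative_inner[OF d d] this], of 1]
  have "snd W \<bullet> v = 0" by (simp add: c(2) inner_commute)
  then show "W \<in> {(X, Z). X \<bullet> q = 0 \<and> X \<bullet> v + Z \<bullet> q = 0 \<and> Z \<bullet> v = 0}"
    using tangent_space_unit_tangent_bundle_subset[OF W]
    by (auto simp: inner_commute split: prod.split)
next
  fix W assume "W \<in> {(X, Z). X \<bullet> q = 0 \<and> X \<bullet> v + Z \<bullet> q = 0 \<and> Z \<bullet> v = 0}"
  then obtain X Z where W: "W = (X, Z)" "X \<bullet> q = 0" "X \<bullet> v + Z \<bullet> q = 0" "Z \<bullet> v = 0"
    by auto
  have qv: "q \<bullet> q = 1" "v \<bullet> v = 1" "v \<bullet> q = 0"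
    using Q unit_tangent_bundle_iff by auto
  \<comment> \<open>The curve is the Gram-Schmidt orthonormalisation of \<open>(q + t X, v + t Z)\<close>; the tangency
    conditions make \<open>\<alpha>\<close>, \<open>\<beta>\<close>, \<open>\<delta>\<close>, its Gram matrix, stationary at \<open>0\<close>.\<close>
  define x where "x t = q + t *\<^sub>R X" for t
  define y where "y t = v + t *\<^sub>R Z" for t
  define \<alpha> where "\<alpha> t = 1 + t * t * (X \<bullet> X)" for t
  define \<beta> where "\<beta> t = 1 + t * t * (Z \<bullet> Z)" for t
  define \<delta> where "\<delta> t = t * t * (X \<bullet> Z)" for t
  \<comment> \<open>The squared norm of \<open>\<alpha> y - \<delta> x\<close>, which is the second
    Gram-Schmidt vector multiplied by \<open>\<alpha>\<close> to avoid a division.\<close>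
  define \<gamma> where "\<gamma> t = \<alpha> t * (\<alpha> t * \<beta> t - \<delta> t * \<delta> t)" for t
  have xy: "x t \<bullet> x t = \<alpha> t" "y t \<bullet> y t = \<beta> t" "x t \<bullet> y t = \<delta> t" for t
  proof -
    have "X \<bullet> v + q \<bullet> Z = 0" using W by (simp add: inner_commute)
    then have "t * (X \<bullet> v) + t * (q \<bullet> Z) = 0" by (metis distrib_left mult_zero_right)
    then show "x t \<bullet> x t = \<alpha> t" "y t \<bullet> y t = \<beta> t" "x t \<bullet> y t = \<delta> t"
      using W qv
      by (simp_all add: x_def y_def \<alpha>_def \<beta>_def \<delta>_def inner_simps inner_commute algebra_simps)
  qed
  have \<alpha>: "\<alpha> t > 0" for t
    by (simp add: \<alpha>_def add_pos_nonneg)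
  \<comment> \<open>Cauchy-Schwarz for \<open>X\<close> and \<open>Z\<close> makes the Gram
    determinant \<open>\<alpha> \<beta> - \<delta> \<delta>\<close> at least 1, for every
    \<open>t\<close>.\<close>
  have \<gamma>: "\<gamma> t > 0" for t
  proof -
    have "(X \<bullet> Z) * (X \<bullet> Z) \<le> (X \<bullet> X) * (Z \<bullet> Z)"
      using Cauchy_Schwarz_ineq[of X Z] by (simp add: power2_eq_square)
    then have "(t * t * (t * t)) * ((X \<bullet> Z) * (X \<bullet> Z)) \<le> (t * t * (t * t)) * ((X \<bullet> X) * (Z \<bullet> Z))"
      by (intro mult_left_mono) auto
    moreover have "t * t * (X \<bullet> X) \<ge> 0" "t * t * (Z \<bullet> Z) \<ge> 0" by auto
    ultimately have "\<alpha> t * \<beta> t - \<delta> t * \<delta> t > 0"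
      unfolding \<alpha>_def \<beta>_def \<delta>_def by (simp add: algebra_simps)
    then show ?thesis by (simp add: \<gamma>_def \<alpha>)
  qed
  define c where "c t = (inverse (sqrt (\<alpha> t)) *\<^sub>R x t,
      inverse (sqrt (\<gamma> t)) *\<^sub>R (\<alpha> t *\<^sub>R y t + (- \<delta> t) *\<^sub>R x t))" for t
  have "c t \<in> unit_tangent_bundle" for t
  proof -
    have "\<gamma> t = \<alpha> t * (\<alpha> t * \<beta> t) - \<alpha> t * (\<delta> t * \<delta> t)" by (simp add: \<gamma>_def algebra_simps)
    then have "(\<alpha> t *\<^sub>R y t + (- \<delta> t) *\<^sub>R x t) \<bullet> (\<alpha> t *\<^sub>R y t + (- \<delta> t) *\<^sub>R x t) = \<gamma> t"
      "(\<alpha> t *\<^sub>R y t + (- \<delta> t) *\<^sub>R x t) \<bullet> x t = 0"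
      using xy[of t] by (simp_all add: inner_simps inner_commute algebra_simps)
    moreover have "inverse (sqrt a) * (inverse (sqrt a) * a) = 1" if "a > 0" for a
      using that by (simp add: field_simps)
    ultimately show ?thesis
      using \<alpha>[of t] \<gamma>[of t] xy(1)[of t]
      by (simp only: c_def unit_tangent_bundle_iff inner_scaleR_left inner_scaleR_right) simp
  qed
  moreover have "smooth_on {-1<..<1} c"
  proof -
    have id: "smooth_on {-1<..<1} (\<lambda>t::real. t)" by (rule smooth_on_ident)
    have x: "smooth_on {-1<..<1} x" and y: "smooth_on {-1<..<1} y"
      and \<alpha>': "smooth_on {-1<..<1} \<alpha>" and \<beta>': "smooth_on {-1<..<1} \<beta>" and \<delta>': "smooth_on {-1<..<1} \<delta>"
      unfolding x_def[abs_def] y_def[abs_def] \<alpha>_def[abs_def] \<beta>_def[abs_def] \<delta>_def[abs_def]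
      by (intro smooth_on_add smooth_on_bilinear[OF bounded_bilinear_scaleR]
          smooth_on_bilinear[OF bounded_bilinear_mult] smooth_on_const id; simp)+
    have "smooth_on {-1<..<1} (\<lambda>t. \<alpha> t * (\<alpha> t * \<beta> t + (- 1) * (\<delta> t * \<delta> t)))"
      by (intro smooth_on_add smooth_on_bilinear[OF bounded_bilinear_mult] smooth_on_const
          \<alpha>' \<beta>' \<delta>'; simp)
    then have \<gamma>': "smooth_on {-1<..<1} \<gamma>" by (simp add: \<gamma>_def[abs_def])
    have "smooth_on {-1<..<1} (\<lambda>t. inverse (sqrt (\<alpha> t)) *\<^sub>R x t)"
      "smooth_on {-1<..<1} (\<lambda>t. inverse (sqrt (\<gamma> t)) *\<^sub>R (\<alpha> t *\<^sub>R y t + ((- 1) * \<delta> t) *\<^sub>R x t))"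
      by (intro smooth_on_add smooth_on_bilinear[OF bounded_bilinear_scaleR]
          smooth_on_bilinear[OF bounded_bilinear_mult] smooth_on_const
          smooth_on_inverse_sqrt x y \<alpha> \<alpha>' \<gamma> \<gamma>' \<delta>'; simp)+
    from smooth_on_Pair[OF open_greaterThanLessThan this] show ?thesis
      by (simp add: c_def[abs_def])
  qed
  moreover have "c 0 = (q, v)"
    by (simp add: c_def x_def y_def \<alpha>_def \<beta>_def \<gamma>_def \<delta>_def)
  moreover have "(c has_vector_derivative W) (at 0)"
  proof -
    have "(x has_derivative (\<lambda>t. t *\<^sub>R X)) (at 0)" "(y has_derivative (\<lambda>t. t *\<^sub>R Z)) (at 0)"
      unfolding x_def[abs_def] y_def[abs_def] by (auto intro!: derivative_eq_intros)
    moreover have \<alpha>': "(\<alpha> has_real_derivative 0) (at 0)" and \<beta>': "(\<beta> has_real_derivative 0) (at 0)"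
      and \<delta>': "(\<delta> has_real_derivative 0) (at 0)"
      unfolding \<alpha>_def[abs_def] \<beta>_def[abs_def] \<delta>_def[abs_def]
      by (auto intro!: derivative_eq_intros)
    moreover have \<gamma>': "(\<gamma> has_real_derivative 0) (at 0)"
      unfolding \<gamma>_def[abs_def] by (auto intro!: derivative_eq_intros \<alpha>' \<beta>' \<delta>')
    moreover have "((\<lambda>t. inverse (sqrt (\<alpha> t))) has_real_derivative 0) (at 0)"
      "((\<lambda>t. inverse (sqrt (\<gamma> t))) has_real_derivative 0) (at 0)"
      using \<alpha>[of 0] \<gamma>[of 0] by (auto intro!: derivative_eq_intros \<alpha>' \<gamma>')
    moreover have "x 0 = q" "y 0 = v" "\<alpha> 0 = 1" "\<delta> 0 = 0" "\<gamma> 0 = 1"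
      by (simp_all add: x_def y_def \<alpha>_def \<beta>_def \<gamma>_def \<delta>_def)
    ultimately show ?thesis
      unfolding c_def[abs_def] has_vector_derivative_def has_field_derivative_def W(1)
      by (auto intro!: derivative_eq_intros simp: fun_eq_iff)
  qed
  ultimately show "W \<in> tangent_space unit_tangent_bundle (q, v)"
    unfolding tangent_space_def by (auto intro!: exI[of _ 1] exI[of _ c])
qed

lemma smooth_vector_field_unit_tangent_bundle_iff:
  "smooth_vector_field unit_tangent_bundle W \<longleftrightarrow>
    smooth_map_on unit_tangent_bundle W \<and>
    (\<forall>(q, v)\<in>unit_tangent_bundle. fst (W (q, v)) \<bullet> q = 0 \<and>
      fst (W (q, v)) \<bullet> v + snd (W (q, v)) \<bullet> q = 0 \<and> snd (W (q, v)) \<bullet> v = 0)"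
  unfolding smooth_vector_field_def
  by (auto simp: tangent_space_unit_tangent_bundle case_prod_unfold)

section \<open>Uniqueness of the Levi-Civita connection\<close>

lemma levi_civita_unique:
  assumes D: "levi_civita M g D" and D': "levi_civita M g D'"
    and g: "\<And>p. p \<in> M \<Longrightarrow> bilinear (g p)"
      "\<And>p u v. p \<in> M \<Longrightarrow> g p u v = g p v u"
      "\<And>p u. p \<in> M \<Longrightarrow> u \<in> tangent_space M p \<Longrightarrow> g p u u = 0 \<Longrightarrow> u = 0"
    and M: "\<And>p. p \<in> M \<Longrightarrow> subspace (tangent_space M p)"
    and X: "smooth_vector_field M X" and Y: "smooth_vector_field M Y" and p: "p \<in> M"
  shows "D X Y p = D' X Y p"
proof -
  \<comment> \<open>The difference tensor is symmetric in its first two slots and skew in its last two.\<close>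
  define t where "t X Y Z = g p (D X Y p - D' X Y p) (Z p)" for X Y Z
  have metric: "diff_on M (\<lambda>x. g x (Y x) (Z x)) p (X p) = g p (E X Y p) (Z p) + g p (Y p) (E X Z p)"
    and torsion: "E X Y p - E Y X p = lie_bracket_on M X Y p"
    if "levi_civita M g E"
      "smooth_vector_field M X" "smooth_vector_field M Y" "smooth_vector_field M Z" for E X Y Z
    using that p unfolding levi_civita_def by blast+
  have skew: "t X Y Z = - t X Z Y"
    if "smooth_vector_field M X" "smooth_vector_field M Y" "smooth_vector_field M Z" for X Y Z
    using metric[OF D that] metric[OF D' that]
      g(2)[OF p, of "Y p" "D X Z p"] g(2)[OF p, of "Y p" "D' X Z p"]
    unfolding t_def bilinear_lsub[OF g(1)[OF p]] by linarith
  have sym: "t X Y Z = t Y X Z"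
    if "smooth_vector_field M X" "smooth_vector_field M Y" for X Y Z
  proof -
    have "D X Y p - D' X Y p = D Y X p - D' Y X p"
      using torsion[OF D that that(1)] torsion[OF D' that that(1)] by (simp add: algebra_simps)
    then show ?thesis by (simp add: t_def)
  qed
  \<comment> \<open>The difference of the two derivatives is itself a smooth vector field, so it can
    serve as the test field in the third slot; no extension of tangent vectors to fields is
    required.\<close>
  define S where "S x = D X Y x - D' X Y x" for x
  have closed: "\<forall>X Y. smooth_vector_field M X \<longrightarrow> smooth_vector_field M Y \<longrightarrow> smooth_vector_field M (E X Y)"
    if "levi_civita M g E" for E
    using that unfolding levi_civita_def affine_connection_def by (elim conjE)
  have "smooth_vector_field M (D X Y)" "smooth_vector_field M (D' X Y)"
    using closed[OF D] closed[OF D'] X Y by simp_all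
  then have S: "smooth_vector_field M S"
    unfolding smooth_vector_field_def S_def[abs_def]
    by (simp add: smooth_map_on_diff subspace_diff M)
  \<comment> \<open>Alternating the skew and the symmetric exchange gives \<open>t X Y S = - t X S Y
    = - t S X Y = t S Y X = t Y S X = - t Y X S = - t X Y S\<close>.\<close>
  have "t X Y S = 0"
    using skew[OF X Y S] sym[OF X S, of Y] skew[OF S X Y] sym[OF S Y, of X] skew[OF Y S X]
      sym[OF Y X, of S]
    by linarith
  then have "g p (S p) (S p) = 0" by (simp add: t_def S_def)
  then have "S p = 0"
    using g(3)[OF p] S p unfolding smooth_vector_field_def by blast
  then show ?thesis by (simp add: S_def)
qed

section \<open>The explicit connection of the Sasaki metric\<close>

text \<open>
  The unit tangent bundle is the Stiefel manifold of orthonormal pairs, and the Sasaki metric is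
  its canonical metric (normal homogeneous for the orthogonal group).  The Christoffel form below
  is the polarisation of \<open>\<Gamma>(\<Delta>, \<Delta>) = \<Delta>\<Delta>\<^sup>TQ + Q\<Delta>\<^sup>T(I - QQ\<^sup>T)\<Delta>\<close> for \<open>Q = (q, v)\<close> as a matrix with two
  columns.
\<close>

definition sasaki_christoffel ::
  "'a::euclidean_space \<times> 'a \<Rightarrow> 'a \<times> 'a \<Rightarrow> 'a \<times> 'a \<Rightarrow> 'a \<times> 'a" where
  "sasaki_christoffel Q W W' =
    ((1 / 2) *\<^sub>R ((snd W' \<bullet> fst Q) *\<^sub>R snd W + (snd W \<bullet> fst Q) *\<^sub>R snd W')
       + (fst W \<bullet> fst W' - (snd W \<bullet> fst Q) * (snd W' \<bullet> fst Q)) *\<^sub>R fst Q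
       + ((1 / 2) * (fst W \<bullet> snd W' + fst W' \<bullet> snd W)) *\<^sub>R snd Q,
     (- 1 / 2) *\<^sub>R ((snd W' \<bullet> fst Q) *\<^sub>R fst W + (snd W \<bullet> fst Q) *\<^sub>R fst W')
       + ((1 / 2) * (fst W \<bullet> snd W' + fst W' \<bullet> snd W)) *\<^sub>R fst Q
       + (snd W \<bullet> snd W' - (snd W \<bullet> fst Q) * (snd W' \<bullet> fst Q)) *\<^sub>R snd Q)"

definition sasaki_connection ::
  "('a::euclidean_space \<times> 'a \<Rightarrow> 'a \<times> 'a) \<Rightarrow> ('a \<times> 'a \<Rightarrow> 'a \<times> 'a) \<Rightarrow> 'a \<times> 'a \<Rightarrow> 'a \<times> 'a" where
  "sasaki_connection W W' Q =
    diff_on unit_tangent_bundle W' Q (W Q) + sasaki_christoffel Q (W Q) (W' Q)"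

lemma bilinear_sasaki_christoffel: "bilinear (sasaki_christoffel Q)"
  unfolding bilinear_def
  by (auto intro!: linearI simp: sasaki_christoffel_def prod_eq_iff algebra_simps inner_simps
        add_divide_distrib)

lemma sasaki_christoffel_commute: "sasaki_christoffel Q W W' = sasaki_christoffel Q W' W"
  by (simp add: sasaki_christoffel_def inner_commute algebra_simps)

lemma bilinear_sasaki_metric: "bilinear (sasaki_metric Q)"
  unfolding bilinear_def
  by (auto intro!: linearI simp: sasaki_metric_def tangential_def inner_simps algebra_simps)

lemma sasaki_metric_commute: "sasaki_metric Q W W' = sasaki_metric Q W' W"
  by (simp add: sasaki_metric_def inner_commute)

text \<open>The vertical part of \<open>W\<close> is \<open>snd W\<close> without its component
  along \<open>q\<close>. This polynomial form is the one that gets differentiated.\<close>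

lemma sasaki_metric_eq:
  "q \<bullet> q = 1 \<Longrightarrow> sasaki_metric (q, v) W W'
    = fst W \<bullet> fst W' + snd W \<bullet> snd W' - (snd W \<bullet> q) * (snd W' \<bullet> q)"
  by (simp add: sasaki_metric_def tangential_def inner_simps inner_commute algebra_simps)

text \<open>On the ambient space the form degenerates at \<open>(0, q)\<close>. For tangent
  \<open>W\<close> the horizontal and the vertical part both vanish, and together they determine
  \<open>W\<close>.\<close>

lemma sasaki_metric_definite:
  assumes Q: "Q \<in> unit_tangent_bundle" and W: "W \<in> tangent_space unit_tangent_bundle Q"
    and 0: "sasaki_metric Q W W = 0"
  shows "W = 0"
proof -
  have "fst W \<bullet> fst W = 0" "tangential (fst Q) (snd W) \<bullet> tangential (fst Q) (snd W) = 0"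
    using 0 inner_ge_zero[of "fst W"] inner_ge_zero[of "tangential (fst Q) (snd W)"]
    unfolding sasaki_metric_def by linarith+
  then have "fst W = 0" "tangential (fst Q) (snd W) = 0" by auto
  then show ?thesis
    using horizontal_vertical_decomposition[of W "fst Q" "snd Q"] W
    by (simp add: horizontal_lift_def vertical_lift_def zero_prod_def)
qed

lemma subspace_tangent_space_unit_tangent_bundle:
  assumes "Q \<in> unit_tangent_bundle"
  shows "subspace (tangent_space unit_tangent_bundle Q)"
proof -
  obtain q v where Q: "Q = (q, v)" by (cases Q)
  show ?thesis
    using assms unfolding Q
    by (subst tangent_space_unit_tangent_bundle)
      (auto simp: subspace_def zero_prod_def inner_simps add_eq_0_iff algebra_simps)
qed

text \<open>Differentiating the three tangency conditions of \<open>W'\<close> along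
  \<open>W\<close> shows how far the Euclidean derivative is from being tangent; the Christoffel
  form corrects exactly this.\<close>

lemma smooth_vector_field_sasaki_connection:
  fixes W W' :: "'a::euclidean_space \<times> 'a \<Rightarrow> 'a \<times> 'a"
  assumes W: "smooth_vector_field unit_tangent_bundle W"
    and W': "smooth_vector_field unit_tangent_bundle W'"
  shows "smooth_vector_field unit_tangent_bundle (sasaki_connection W W')"
  unfolding smooth_vector_field_unit_tangent_bundle_iff
proof (intro conjI ballI, goal_cases)
  case 1
  have sW: "smooth_map_on unit_tangent_bundle W" and sW': "smooth_map_on unit_tangent_bundle W'"
    using W W' by (auto simp: smooth_vector_field_def)
  show ?case
    unfolding sasaki_connection_def[abs_def] sasaki_christoffel_def
    by (intro smooth_map_intros sW sW' smooth_map_on_diff_on W)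
next
  case (2 Q)
  obtain q v where Q: "Q = (q, v)" by (cases Q)
  then have Q': "(q, v) \<in> unit_tangent_bundle" using 2 by simp
  then have qv: "q \<bullet> q = 1" "v \<bullet> v = 1" "v \<bullet> q = 0" "q \<bullet> v = 0"
    by (auto simp: unit_tangent_bundle_iff inner_commute)
  obtain X Z A B where WQ: "W (q, v) = (X, Z)" "W' (q, v) = (A, B)"
    by (cases "W (q, v)"; cases "W' (q, v)")
  have tW: "X \<bullet> q = 0" "X \<bullet> v = - (Z \<bullet> q)" "Z \<bullet> v = 0" "A \<bullet> q = 0" "A \<bullet> v = - (B \<bullet> q)" "B \<bullet> v = 0"
    using W W' Q' WQ by (force simp: smooth_vector_field_unit_tangent_bundle_iff)+
  have WT: "(X, Z) \<in> tangent_space unit_tangent_bundle (q, v)"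
    using W Q' WQ unfolding smooth_vector_field_def by fastforce
  let ?d = "diff_on unit_tangent_bundle W' (q, v)"
  obtain dA dB where d: "?d (X, Z) = (dA, dB)" by (cases "?d (X, Z)")
  have dW': "(W' has_derivative ?d) (at (q, v) within unit_tangent_bundle)"
    using W' Q' unfolding smooth_vector_field_def by (blast intro: smooth_map_on_has_derivative)
  note dA = has_derivative_fst[OF dW'] and dB = has_derivative_snd[OF dW']
    and dq = has_derivative_fst[OF has_derivative_ident[of "at (q, v) within unit_tangent_bundle"]]
    and dv = has_derivative_snd[OF has_derivative_ident[of "at (q, v) within unit_tangent_bundle"]]
  \<comment> \<open>A function vanishing on the bundle may have nonzero derivatives within the
    bundle as linear maps, but each of them vanishes on the tangent vector
    \<open>(X, Z)\<close>.\<close>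
  have zero: "L (X, Z) = 0"
    if "(f has_derivative L) (at (q, v) within unit_tangent_bundle)"
      "\<And>Q. Q \<in> unit_tangent_bundle \<Longrightarrow> f Q = 0" for f :: "'a \<times> 'a \<Rightarrow> real" and L
  proof -
    have "(f has_derivative (\<lambda>_. 0)) (at (q, v) within unit_tangent_bundle)"
      by (rule has_derivative_transform[OF Q' _ has_derivative_const]) (simp add: that(2))
    with that(1) show ?thesis using diff_on_eqI[OF _ WT] by metis
  qed
  have c: "fst (W' P) \<bullet> fst P = 0" "fst (W' P) \<bullet> snd P + snd (W' P) \<bullet> fst P = 0"
    "snd (W' P) \<bullet> snd P = 0" if "P \<in> unit_tangent_bundle" for P
    using W' that by (force simp: smooth_vector_field_unit_tangent_bundle_iff)+
  have 1: "A \<bullet> X + dA \<bullet> q = 0"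
    using zero[OF has_derivative_inner[OF dA dq] c(1)] by (simp add: WQ d)
  have 2: "A \<bullet> Z + dA \<bullet> v + (B \<bullet> X + dB \<bullet> q) = 0"
    using zero[OF has_derivative_add[OF has_derivative_inner[OF dA dv]
          has_derivative_inner[OF dB dq]] c(2)] by (simp add: WQ d)
  have 3: "B \<bullet> Z + dB \<bullet> v = 0"
    using zero[OF has_derivative_inner[OF dB dv] c(3)] by (simp add: WQ d)
  show ?case
    unfolding Q case_prod_conv sasaki_connection_def sasaki_christoffel_def WQ d
    using 1 2 3
    by (simp add: inner_simps qv tW inner_commute[of X A] inner_commute[of Z B]
        inner_commute[of X B] algebra_simps)
qed

text \<open>Torsion-freeness is the symmetry of the Christoffel form. Compatibility with the metric
  is the product rule for the polynomial form of the metric, simplified by the tangency conditions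
  of the three fields.\<close>

theorem levi_civita_sasaki_connection:
  "levi_civita (unit_tangent_bundle :: ('a::euclidean_space \<times> 'a) set) sasaki_metric sasaki_connection"
  unfolding levi_civita_def affine_connection_def
proof (intro conjI allI impI ballI)
  fix U V :: "'a \<times> 'a \<Rightarrow> 'a \<times> 'a"
  assume U: "smooth_vector_field unit_tangent_bundle U"
    and V: "smooth_vector_field unit_tangent_bundle V"
  show "smooth_vector_field unit_tangent_bundle (sasaki_connection U V)"
    using U V by (rule smooth_vector_field_sasaki_connection)
  {
    fix Q :: "'a \<times> 'a" assume Q: "Q \<in> unit_tangent_bundle"
    note dU = smooth_map_on_has_derivative[OF conjunct1[OF U[unfolded smooth_vector_field_def]] Q]
      and dV = smooth_map_on_has_derivative[OF conjunct1[OF V[unfolded smooth_vector_field_def]] Q]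
    have UT: "U Q \<in> tangent_space unit_tangent_bundle Q"
      using U Q unfolding smooth_vector_field_def by blast
    show "sasaki_connection U V Q - sasaki_connection V U Q = lie_bracket_on unit_tangent_bundle U V Q"
      by (simp add: sasaki_connection_def lie_bracket_on_def sasaki_christoffel_commute)
    {
      fix f :: "'a \<times> 'a \<Rightarrow> real" assume f: "smooth_map_on unit_tangent_bundle f"
      show "sasaki_connection (\<lambda>x. f x *\<^sub>R U x) V Q = f Q *\<^sub>R sasaki_connection U V Q"
        using has_derivative_linear[OF dV] bilinear_lmul[OF bilinear_sasaki_christoffel]
        by (simp add: sasaki_connection_def linear_scale algebra_simps)
      have "((\<lambda>x. f x *\<^sub>R V x) has_derivative (\<lambda>h. f Q *\<^sub>R diff_on unit_tangent_bundle V Q h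
          + diff_on unit_tangent_bundle f Q h *\<^sub>R V Q)) (at Q within unit_tangent_bundle)"
        by (intro has_derivative_scaleR dV smooth_map_on_has_derivative f Q)
      from diff_on_eqI[OF this UT]
      show "sasaki_connection U (\<lambda>x. f x *\<^sub>R V x) Q =
          diff_on unit_tangent_bundle f Q (U Q) *\<^sub>R V Q + f Q *\<^sub>R sasaki_connection U V Q"
        using bilinear_rmul[OF bilinear_sasaki_christoffel]
        by (simp add: sasaki_connection_def algebra_simps)
    }
    {
      fix W :: "'a \<times> 'a \<Rightarrow> 'a \<times> 'a" assume W: "smooth_vector_field unit_tangent_bundle W"
      note dW = smooth_map_on_has_derivative[OF conjunct1[OF W[unfolded smooth_vector_field_def]] Q]
      show "sasaki_connection (\<lambda>x. U x + V x) W Q = sasaki_connection U W Q + sasaki_connection V W Q"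
        using has_derivative_linear[OF dW] bilinear_ladd[OF bilinear_sasaki_christoffel]
        by (simp add: sasaki_connection_def linear_add algebra_simps)
      show "sasaki_connection U (\<lambda>x. V x + W x) Q = sasaki_connection U V Q + sasaki_connection U W Q"
        using diff_on_eqI[OF has_derivative_add[OF dV dW] UT]
          bilinear_radd[OF bilinear_sasaki_christoffel]
        by (simp add: sasaki_connection_def algebra_simps)
      obtain q v where Qqv: "Q = (q, v)" by (cases Q)
      then have qv: "q \<bullet> q = 1" "v \<bullet> v = 1" "v \<bullet> q = 0" "q \<bullet> v = 0"
        using Q by (auto simp: unit_tangent_bundle_iff inner_commute)
      obtain X Z A B A' B' where UVW: "U Q = (X, Z)" "V Q = (A, B)" "W Q = (A', B')"
        by (cases "U Q"; cases "V Q"; cases "W Q")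
      have t: "X \<bullet> q = 0" "X \<bullet> v = - (Z \<bullet> q)" "Z \<bullet> v = 0" "A \<bullet> q = 0" "A \<bullet> v = - (B \<bullet> q)" "B \<bullet> v = 0"
          "A' \<bullet> q = 0" "A' \<bullet> v = - (B' \<bullet> q)" "B' \<bullet> v = 0"
        using U V W Q UVW unfolding Qqv
        by (force simp: smooth_vector_field_unit_tangent_bundle_iff)+
      let ?dV = "diff_on unit_tangent_bundle V Q" and ?dW = "diff_on unit_tangent_bundle W Q"
      obtain dA dB dA' dB' where d: "?dV (X, Z) = (dA, dB)" "?dW (X, Z) = (dA', dB')"
        by (cases "?dV (X, Z)"; cases "?dW (X, Z)")
      let ?g = "\<lambda>x. fst (V x) \<bullet> fst (W x) + snd (V x) \<bullet> snd (W x)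
          - (snd (V x) \<bullet> fst x) * (snd (W x) \<bullet> fst x)"
      note d' = has_derivative_fst[OF dV] has_derivative_snd[OF dV] has_derivative_fst[OF dW]
        has_derivative_snd[OF dW] has_derivative_fst[OF has_derivative_ident]
      let ?L = "\<lambda>h. fst (V Q) \<bullet> fst (?dW h) + fst (?dV h) \<bullet> fst (W Q)
          + (snd (V Q) \<bullet> snd (?dW h) + snd (?dV h) \<bullet> snd (W Q))
          - ((snd (V Q) \<bullet> fst Q) * (snd (W Q) \<bullet> fst h + snd (?dW h) \<bullet> fst Q)
            + (snd (V Q) \<bullet> fst h + snd (?dV h) \<bullet> fst Q) * (snd (W Q) \<bullet> fst Q))"
      have dg: "(?g has_derivative ?L) (at Q within unit_tangent_bundle)"
        by (intro has_derivative_diff has_derivative_add has_derivative_mult has_derivative_inner d')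
      have g: "sasaki_metric x (V x) (W x) = ?g x" if "x \<in> unit_tangent_bundle" for x
        using that sasaki_metric_eq[of "fst x" "snd x"] unit_tangent_bundle_iff[of "fst x" "snd x"]
        by simp
      have "((\<lambda>x. sasaki_metric x (V x) (W x)) has_derivative ?L) (at Q within unit_tangent_bundle)"
        using Q g dg by (rule has_derivative_transform)
      note dg = diff_on_eqI[OF this UT]
      note c = inner_commute[of A A'] inner_commute[of B B'] inner_commute[of A X]
        inner_commute[of B X] inner_commute[of A Z] inner_commute[of B Z] inner_commute[of A' X]
        inner_commute[of B' X] inner_commute[of A' Z] inner_commute[of B' Z]
        inner_commute[of A B'] inner_commute[of B A'] inner_commute[of q A']
        inner_commute[of q B'] inner_commute[of v A'] inner_commute[of v B']
      show "diff_on unit_tangent_bundle (\<lambda>x. sasaki_metric x (V x) (W x)) Q (U Q) =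
          sasaki_metric Q (sasaki_connection U V Q) (W Q) + sasaki_metric Q (V Q) (sasaki_connection U W Q)"
        unfolding dg
        unfolding UVW d sasaki_connection_def sasaki_christoffel_def
        unfolding Qqv sasaki_metric_eq[OF qv(1)]
        by (simp add: UVW d inner_simps qv t c algebra_simps)
    }
  }
qed

section \<open>Graphs of unit vector fields\<close>

abbreviation graph_on_sphere :: "('a::euclidean_space \<Rightarrow> 'a) \<Rightarrow> ('a \<times> 'a) set" where
  "graph_on_sphere \<xi> \<equiv> (\<lambda>q. (q, \<xi> q)) ` unit_sphere"

lemma has_derivative_unique_tangent:
  assumes "(f has_derivative L) (at p within M)" "(f has_derivative L') (at p within M)"
    and "v \<in> tangent_space M p"
  shows "L v = L' v"
  using diff_on_eqI[OF assms(1,3)] diff_on_eqI[OF assms(2,3)] by simp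

lemma has_derivative_compose_fst:
  assumes "smooth_map_on M f" "q \<in> M" "fst ` N \<subseteq> M"
  shows "((\<lambda>P. f (fst P)) has_derivative (\<lambda>h. diff_on M f q (fst h))) (at (q, v) within N)"
proof -
  have "(f has_derivative diff_on M f q) (at (fst (q, v)) within fst ` N)"
    using has_derivative_subset[OF smooth_map_on_has_derivative[OF assms(1,2)] assms(3)] by simp
  from diff_chain_within[OF has_derivative_fst[OF has_derivative_ident] this]
  show ?thesis by (simp add: o_def)
qed

text \<open>A curve in the graph projects to the sphere, and \<open>snd P - \<xi> (fst P)\<close>
  vanishes along it. Conversely a curve in the sphere is lifted to the graph by a local smooth
  extension of \<open>\<xi>\<close>.\<close>

lemma tangent_space_graph:
  fixes \<xi> :: "'a::euclidean_space \<Rightarrow> 'a"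
  assumes \<xi>: "smooth_map_on unit_sphere \<xi>" and q: "q \<in> unit_sphere"
  shows "tangent_space (graph_on_sphere \<xi>) (q, \<xi> q) = {(u, diff_on unit_sphere \<xi> q u) |u. u \<bullet> q = 0}"
proof (intro equalityI subsetI)
  let ?N = "graph_on_sphere \<xi>"
  fix W assume W: "W \<in> tangent_space ?N (q, \<xi> q)"
  then obtain e c where e: "e > 0" and c: "smooth_on {-e<..<e} c" "c ` {-e<..<e} \<subseteq> ?N"
      "c 0 = (q, \<xi> q)" "(c has_vector_derivative W) (at 0)"
    unfolding tangent_space_def by blast
  have "smooth_on {-e<..<e} (\<lambda>t. fst (c t))"
    by (rule smooth_on_bounded_linear[OF bounded_linear_fst open_greaterThanLessThan c(1)])
  moreover have "(\<lambda>t. fst (c t)) ` {-e<..<e} \<subseteq> unit_sphere"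
    using c(2) by force
  moreover have "((\<lambda>t. fst (c t)) has_vector_derivative fst W) (at 0)"
    using has_derivative_fst[OF c(4)[unfolded has_vector_derivative_def]]
    by (simp add: has_vector_derivative_def)
  ultimately have "fst W \<in> tangent_space unit_sphere q"
    unfolding tangent_space_def using e c(3) by (intro CollectI exI[of _ e] exI[of _ "\<lambda>t. fst (c t)"] conjI) simp_all
  then have 1: "fst W \<bullet> q = 0" using tangent_space_sphere[OF q] by simp
  have sub: "fst ` ?N \<subseteq> unit_sphere" and Q: "(q, \<xi> q) \<in> ?N" using q by auto
  have "((\<lambda>P. snd P - \<xi> (fst P)) has_derivative (\<lambda>h. snd h - diff_on unit_sphere \<xi> q (fst h)))
      (at (q, \<xi> q) within ?N)"
    by (intro has_derivative_diff has_derivative_snd has_derivative_ident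
        has_derivative_compose_fst \<xi> q sub)
  moreover have "((\<lambda>P. snd P - \<xi> (fst P)) has_derivative (\<lambda>h. 0)) (at (q, \<xi> q) within ?N)"
    by (rule has_derivative_transform[OF Q _ has_derivative_const]) auto
  ultimately have "snd W - diff_on unit_sphere \<xi> q (fst W) = 0"
    using W by (rule has_derivative_unique_tangent)
  then show "W \<in> {(u, diff_on unit_sphere \<xi> q u) |u. u \<bullet> q = 0}"
    using 1 by (cases W) auto
next
  fix W assume "W \<in> {(u, diff_on unit_sphere \<xi> q u) |u. u \<bullet> q = 0}"
  then obtain u where u: "u \<bullet> q = 0" and W: "W = (u, diff_on unit_sphere \<xi> q u)" by auto
  then have u': "u \<in> tangent_space unit_sphere q" using tangent_space_sphere[OF q] by simp
  then obtain e c where e: "e > 0" and c: "smooth_on {-e<..<e} c" "c ` {-e<..<e} \<subseteq> unit_sphere"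
      "c 0 = q" "(c has_vector_derivative u) (at 0)"
    unfolding tangent_space_def by blast
  obtain U F where F: "open U" "q \<in> U" "smooth_on U F"
    "\<And>x. x \<in> U \<Longrightarrow> x \<in> unit_sphere \<Longrightarrow> F x = \<xi> x"
    using smooth_map_onE[OF \<xi> q] by blast
  \<comment> \<open>The interval is shrunk until the curve stays in the domain \<open>U\<close> of
    the local extension \<open>F\<close>.\<close>
  have "open ({-e<..<e} \<inter> c -` U)"
    by (rule continuous_open_preimage[OF smooth_on_imp_continuous_on[OF c(1)] _ F(1)]) simp
  moreover have "0 \<in> {-e<..<e} \<inter> c -` U" using e c(3) F(2) by simp
  ultimately obtain d where d: "d > 0" "ball 0 d \<subseteq> {-e<..<e} \<inter> c -` U" using openE by blast
  then have I: "{-d<..<d} \<subseteq> {-e<..<e} \<inter> c -` U" by (simp add: ball_eq_greaterThanLessThan)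
  then have cI: "smooth_on {-d<..<d} c" using c(1) by (blast intro: smooth_on_subset)
  have Fc: "smooth_on {-d<..<d} (\<lambda>t. F (c t))"
    by (rule smooth_on_compose[OF _ F(1) _ F(3) cI]) (use I in auto)
  let ?c = "\<lambda>t. (c t, F (c t))"
  have "smooth_on {-d<..<d} ?c"
    by (rule smooth_on_Pair[OF open_greaterThanLessThan cI Fc])
  moreover have "?c ` {-d<..<d} \<subseteq> graph_on_sphere \<xi>"
  proof (rule image_subsetI)
    fix t assume "t \<in> {-d<..<d}"
    then have "c t \<in> unit_sphere" "c t \<in> U" using I c(2) by blast+
    then show "?c t \<in> graph_on_sphere \<xi>" using F(4) by simp
  qed
  moreover have "F q = \<xi> q" using F(2,4) q by simp
  moreover have "(?c has_vector_derivative W) (at 0)"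
  proof -
    have F': "(F has_derivative frechet_derivative F (at q)) (at (c 0))"
      using smooth_on_imp_has_derivative[OF F(3,2)] c(3) by simp
    have "diff_on unit_sphere \<xi> q u = frechet_derivative F (at q) u"
      by (rule diff_on_eqI[OF has_derivative_transfer_within[OF F(1,2) q F'[unfolded c(3)] F(4)] u'])
    moreover have "linear (frechet_derivative F (at q))"
      using F' has_derivative_linear by blast
    moreover have "(?c has_derivative (\<lambda>h. (h *\<^sub>R u, frechet_derivative F (at q) (h *\<^sub>R u)))) (at 0)"
      using c(4) F' unfolding has_vector_derivative_def
      by (intro has_derivative_Pair) (auto intro: has_derivative_compose)
    ultimately show ?thesis
      by (simp add: has_vector_derivative_def W linear_scale)
  qed
  ultimately show "W \<in> tangent_space (graph_on_sphere \<xi>) (q, \<xi> q)"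
    unfolding tangent_space_def using d(1) by (intro CollectI exI[of _ d] exI[of _ ?c] conjI) (simp_all add: c(3))
qed

text \<open>Derivatives of the relations \<open>\<xi> x \<bullet> \<xi> x = 1\<close> and
  \<open>\<xi> x \<bullet> x = 0\<close>. The second identifies the covariant derivative
  \<open>\<phi> u\<close> as \<open>d\<xi> u + (u \<bullet> \<xi> q) q\<close>.\<close>

lemma diff_on_unit_vector_field:
  assumes \<xi>: "unit_vector_field \<xi>" and q: "q \<in> unit_sphere" and u: "u \<bullet> q = 0"
  shows "diff_on unit_sphere \<xi> q u \<bullet> \<xi> q = 0" "diff_on unit_sphere \<xi> q u \<bullet> q = - (u \<bullet> \<xi> q)"
proof -
  have u': "u \<in> tangent_space unit_sphere q" using tangent_space_sphere[OF q] u by simp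
  have s: "smooth_map_on unit_sphere \<xi>" and n: "\<And>x. x \<in> unit_sphere \<Longrightarrow> \<xi> x \<bullet> \<xi> x = 1"
    using \<xi> unfolding unit_vector_field_def smooth_vector_field_def by (auto simp: dot_square_norm)
  note d = smooth_map_on_has_derivative[OF s q]
  have "((\<lambda>x. \<xi> x \<bullet> \<xi> x) has_derivative (\<lambda>h. 0)) (at q within unit_sphere)"
    by (rule has_derivative_transform[OF q _ has_derivative_const]) (rule n)
  from diff_on_eqI[OF this u'] diff_on_eqI[OF has_derivative_inner[OF d d] u']
  show "diff_on unit_sphere \<xi> q u \<bullet> \<xi> q = 0" by (simp add: inner_commute)
  show "diff_on unit_sphere \<xi> q u \<bullet> q = - (u \<bullet> \<xi> q)"
    using diff_on_vector_field_sphere[OF _ q u] \<xi>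
    by (simp add: unit_vector_field_def inner_commute)
qed

lemma graph_on_sphere_subset:
  assumes "unit_vector_field \<xi>"
  shows "graph_on_sphere \<xi> \<subseteq> unit_tangent_bundle"
  using assms
  by (auto simp: unit_tangent_bundle_iff unit_vector_field_def smooth_vector_field_sphere_iff
      norm_eq_1)

text \<open>
  \<open>(W, d\<xi>(W))\<close> is tangent to the unit tangent bundle only along the graph of \<open>\<xi>\<close>; at the other
  points \<open>(q, v)\<close> the two correction terms project it onto the tangent space.
\<close>

definition graph_lift ::
  "('a::euclidean_space \<Rightarrow> 'a) \<Rightarrow> ('a \<Rightarrow> 'a) \<Rightarrow> 'a \<times> 'a \<Rightarrow> 'a \<times> 'a" where
  "graph_lift \<xi> W P =
    (W (fst P), diff_on unit_sphere \<xi> (fst P) (W (fst P))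
       - (diff_on unit_sphere \<xi> (fst P) (W (fst P)) \<bullet> snd P) *\<^sub>R snd P
       - (diff_on unit_sphere \<xi> (fst P) (W (fst P)) \<bullet> fst P + W (fst P) \<bullet> snd P) *\<^sub>R fst P)"

lemma smooth_vector_field_graph_lift:
  fixes \<xi> :: "'a::euclidean_space \<Rightarrow> 'a"
  assumes \<xi>: "smooth_map_on unit_sphere \<xi>" and W: "smooth_vector_field unit_sphere W"
  shows "smooth_vector_field unit_tangent_bundle (graph_lift \<xi> W)"
proof -
  have sub: "fst ` (unit_tangent_bundle :: ('a \<times> 'a) set) \<subseteq> unit_sphere"
    by (auto simp: unit_tangent_bundle_def)
  have f: "smooth_map_on unit_tangent_bundle (\<lambda>P::'a \<times> 'a. fst P)"
    by (intro smooth_map_on_fst smooth_map_on_ident)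
  have Ws: "smooth_map_on unit_sphere W" using W by (simp add: smooth_vector_field_def)
  have "smooth_map_on unit_tangent_bundle (graph_lift \<xi> W)"
    unfolding graph_lift_def[abs_def]
    by (intro smooth_map_intros smooth_map_on_compose[OF Ws f sub]
        smooth_map_on_compose[OF smooth_map_on_diff_on[OF \<xi> W] f sub])
  moreover have "W q \<bullet> q = 0" if "(q, v) \<in> unit_tangent_bundle" for q v
    using W that by (simp add: smooth_vector_field_sphere_iff unit_tangent_bundle_def)
  ultimately show ?thesis
    by (auto simp: smooth_vector_field_unit_tangent_bundle_iff graph_lift_def
        unit_tangent_bundle_iff inner_simps inner_commute)
qed

lemma graph_lift_graph:
  assumes \<xi>: "unit_vector_field \<xi>" and W: "smooth_vector_field unit_sphere W" and q: "q \<in> unit_sphere"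
  shows "graph_lift \<xi> W (q, \<xi> q) = (W q, diff_on unit_sphere \<xi> q (W q))"
proof -
  have "W q \<bullet> q = 0" using W q by (simp add: smooth_vector_field_sphere_iff)
  from diff_on_unit_vector_field[OF \<xi> q this] show ?thesis
    by (simp add: graph_lift_def)
qed

section \<open>The totally geodesic equation on the sphere\<close>

text \<open>The definition of a totally geodesic submanifold only asserts that some Levi-Civita
  connection works; this replaces it by the explicit one.\<close>

lemma levi_civita_sasaki_unique:
  assumes "levi_civita unit_tangent_bundle sasaki_metric D" "smooth_vector_field unit_tangent_bundle X"
    "smooth_vector_field unit_tangent_bundle Y" "Q \<in> unit_tangent_bundle"
  shows "D X Y Q = sasaki_connection X Y Q"
  by (rule levi_civita_unique[OF assms(1) levi_civita_sasaki_connection _ _ _ _ assms(2-4)])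
    (rule bilinear_sasaki_metric sasaki_metric_commute | erule (2) sasaki_metric_definite
      | erule subspace_tangent_space_unit_tangent_bundle)+

text \<open>The connection is applied to the lifts of \<open>U\<close> and \<open>W\<close>. Along
  the graph the result has the form
  \<open>(dW(U) + fst \<Gamma>, d(d\<xi>(W))(U) + snd \<Gamma>)\<close>, and it is tangent to the
  graph only if \<open>d\<xi>\<close> maps the first component to the second.\<close>

lemma totally_geodesic_equation:
  fixes \<xi> :: "'a::euclidean_space \<Rightarrow> 'a"
  assumes \<xi>: "unit_vector_field \<xi>" and tg: "totally_geodesic \<xi>"
    and U: "smooth_vector_field unit_sphere U" and W: "smooth_vector_field unit_sphere W"
    and q: "q \<in> unit_sphere"
  defines "\<Gamma> \<equiv> sasaki_christoffel (q, \<xi> q) (U q, diff_on unit_sphere \<xi> q (U q))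
    (W q, diff_on unit_sphere \<xi> q (W q))"
  shows "diff_on unit_sphere (\<lambda>x. diff_on unit_sphere \<xi> x (W x)) q (U q) + snd \<Gamma>
    = diff_on unit_sphere \<xi> q (diff_on unit_sphere W q (U q) + fst \<Gamma>)"
proof -
  let ?N = "graph_on_sphere \<xi>"
  let ?X = "graph_lift \<xi> U" and ?Y = "graph_lift \<xi> W" and ?Q = "(q, \<xi> q)"
  let ?G = "\<lambda>x. diff_on unit_sphere \<xi> x (W x)"
  have s: "smooth_map_on unit_sphere \<xi>" and Ws: "smooth_map_on unit_sphere W"
    using \<xi> W by (simp_all add: unit_vector_field_def smooth_vector_field_def)
  have G: "smooth_map_on unit_sphere ?G" by (rule smooth_map_on_diff_on[OF s W])
  have NM: "?N \<subseteq> unit_tangent_bundle" by (rule graph_on_sphere_subset[OF \<xi>])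
  have Q: "?Q \<in> ?N" "?Q \<in> unit_tangent_bundle" using q NM by auto
  have X: "smooth_vector_field unit_tangent_bundle ?X" and Y: "smooth_vector_field unit_tangent_bundle ?Y"
    using smooth_vector_field_graph_lift[OF s] U W by auto
  have tangent: "graph_lift \<xi> V P \<in> tangent_space ?N P" if "smooth_vector_field unit_sphere V" "P \<in> ?N" for V P
    using that s graph_lift_graph[OF \<xi> that(1)] tangent_space_graph[OF s]
    by (auto simp: smooth_vector_field_sphere_iff)
  obtain D where D: "levi_civita unit_tangent_bundle sasaki_metric D"
    and "\<forall>X Y. smooth_vector_field unit_tangent_bundle X \<longrightarrow> smooth_vector_field unit_tangent_bundle Y \<longrightarrow>
           (\<forall>p\<in>?N. X p \<in> tangent_space ?N p) \<longrightarrow> (\<forall>p\<in>?N. Y p \<in> tangent_space ?N p) \<longrightarrow>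
           (\<forall>p\<in>?N. D X Y p \<in> tangent_space ?N p)"
    using tg unfolding totally_geodesic_def totally_geodesic_submanifold_def by blast
  then have "D ?X ?Y ?Q \<in> tangent_space ?N ?Q"
    using X Y Q(1) tangent[OF U] tangent[OF W] by blast
  then have *: "sasaki_connection ?X ?Y ?Q \<in> tangent_space ?N ?Q"
    using levi_civita_sasaki_unique[OF D X Y Q(2)] by simp
  have Ys: "smooth_map_on unit_tangent_bundle ?Y" using Y by (simp add: smooth_vector_field_def)
  have XT: "?X ?Q \<in> tangent_space ?N ?Q" by (rule tangent[OF U Q(1)])
  \<comment> \<open>The direction is tangent to the graph, so the derivative may be taken within the
    graph, where the lift is simply \<open>(W, d\<xi>(W))\<close>.\<close>
  have YN: "(?Y has_derivative diff_on unit_tangent_bundle ?Y ?Q) (at ?Q within ?N)"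
    by (rule has_derivative_subset[OF smooth_map_on_has_derivative[OF Ys Q(2)] NM])
  have sub: "fst ` ?N \<subseteq> unit_sphere" by auto
  have 1: "((\<lambda>P. (W (fst P), ?G (fst P))) has_derivative
      (\<lambda>h. (diff_on unit_sphere W q (fst h), diff_on unit_sphere ?G q (fst h)))) (at ?Q within ?N)"
    by (intro has_derivative_Pair has_derivative_compose_fst sub q Ws G)
  have 2: "?Y P = (W (fst P), ?G (fst P))" if "P \<in> ?N" for P
    using that graph_lift_graph[OF \<xi> W] by auto
  have "(?Y has_derivative
      (\<lambda>h. (diff_on unit_sphere W q (fst h), diff_on unit_sphere ?G q (fst h)))) (at ?Q within ?N)"
    using Q(1) 2 1 by (rule has_derivative_transform)
  from diff_on_eqI[OF this XT] diff_on_eqI[OF YN XT] graph_lift_graph[OF \<xi> U q]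
  have "diff_on unit_tangent_bundle ?Y ?Q (?X ?Q)
      = (diff_on unit_sphere W q (U q), diff_on unit_sphere ?G q (U q))" by simp
  then have "sasaki_connection ?X ?Y ?Q
      = (diff_on unit_sphere W q (U q) + fst \<Gamma>, diff_on unit_sphere ?G q (U q) + snd \<Gamma>)"
    unfolding sasaki_connection_def \<Gamma>_def graph_lift_graph[OF \<xi> U q] graph_lift_graph[OF \<xi> W q]
    by (simp add: prod_eq_iff)
  with * show ?thesis unfolding tangent_space_graph[OF s q] by auto
qed

section \<open>The graph of a Hopf field\<close>

text \<open>Tangent vectors of the graph are the pairs \<open>(u, J u)\<close> with \<open>u\<close>
  orthogonal to \<open>q\<close>. This form survives differentiation because \<open>J\<close> is
  linear, and the Christoffel form preserves it because \<open>J\<close> is orthogonal with square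
  \<open>-1\<close>.\<close>

lemma hopf_imp_totally_geodesic:
  fixes \<xi> :: "'a::euclidean_space \<Rightarrow> 'a"
  assumes \<xi>: "unit_vector_field \<xi>" and "hopf_vector_field \<xi>"
  shows "totally_geodesic \<xi>"
proof -
  obtain J where J: "orthogonal_transformation J" "\<And>x. J (J x) = - x" "\<And>q. q \<in> unit_sphere \<Longrightarrow> \<xi> q = J q"
    using assms(2) unfolding hopf_vector_field_def by blast
  have lJ: "linear J" and iJ: "\<And>x y. J x \<bullet> J y = x \<bullet> y"
    using J(1) by (auto simp: orthogonal_transformation_def)
  have skew: "J x \<bullet> y = - (x \<bullet> J y)" for x y
    using iJ[of x "J y"] by (simp add: J(2))
  have bJ: "bounded_linear J" using lJ by (rule linear_conv_bounded_linear[THEN iffD1])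
  let ?N = "graph_on_sphere \<xi>"
  have s: "smooth_map_on unit_sphere \<xi>"
    using \<xi> by (simp add: unit_vector_field_def smooth_vector_field_def)
  have NM: "?N \<subseteq> unit_tangent_bundle" by (rule graph_on_sphere_subset[OF \<xi>])
  have d\<xi>: "diff_on unit_sphere \<xi> q u = J u" if "q \<in> unit_sphere" "u \<bullet> q = 0" for q u
  proof -
    have "(\<xi> has_derivative J) (at q within unit_sphere)"
      by (rule has_derivative_transform[OF that(1) J(3)
            bounded_linear_imp_has_derivative[OF bJ]])
    then show ?thesis using that tangent_space_sphere[OF that(1)] by (intro diff_on_eqI) auto
  qed
  have TN: "tangent_space ?N (q, \<xi> q) = {(u, J u) |u. u \<bullet> q = 0}" if "q \<in> unit_sphere" for q
    unfolding tangent_space_graph[OF s that] using d\<xi>[OF that] by force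
  have "sasaki_connection X Y p \<in> tangent_space ?N p"
    if X: "smooth_vector_field unit_tangent_bundle X" and Y: "smooth_vector_field unit_tangent_bundle Y"
      and XN: "\<forall>p\<in>?N. X p \<in> tangent_space ?N p" and YN: "\<forall>p\<in>?N. Y p \<in> tangent_space ?N p"
      and p: "p \<in> ?N" for X Y p
  proof -
    obtain q where q: "q \<in> unit_sphere" and pq: "p = (q, \<xi> q)" using p by auto
    have Q: "p \<in> unit_tangent_bundle" using NM p by blast
    obtain u w where u: "X p = (u, J u)" "u \<bullet> q = 0" and w: "Y p = (w, J w)" "w \<bullet> q = 0"
      using XN YN p TN[OF q] unfolding pq by blast
    let ?d = "diff_on unit_tangent_bundle Y p"
    have dY: "(Y has_derivative ?d) (at p within ?N)"
      using Y unfolding smooth_vector_field_def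
      by (blast intro: has_derivative_subset[OF smooth_map_on_has_derivative[OF _ Q] NM])
    have "((\<lambda>x. snd (Y x) - J (fst (Y x))) has_derivative (\<lambda>h. snd (?d h) - J (fst (?d h)))) (at p within ?N)"
      by (intro has_derivative_diff has_derivative_snd has_derivative_fst dY
          bounded_linear.has_derivative[OF bJ])
    moreover have "((\<lambda>x. snd (Y x) - J (fst (Y x))) has_derivative (\<lambda>h. 0)) (at p within ?N)"
    proof (rule has_derivative_transform[OF p _ has_derivative_const])
      fix x assume x: "x \<in> ?N"
      then obtain r where "r \<in> unit_sphere" "x = (r, \<xi> r)" by auto
      then show "snd (Y x) - J (fst (Y x)) = 0" using YN x TN[of r] by auto
    qed
    ultimately have "snd (?d (X p)) - J (fst (?d (X p))) = 0"
      using XN[rule_format, OF p] by (rule has_derivative_unique_tangent)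
    then obtain h where h: "?d (X p) = (h, J h)" by (simp add: prod_eq_iff)
    \<comment> \<open>This coefficient multiplies \<open>J q\<close> in the first component of the
      Christoffel form and \<open>q\<close> in the second, while \<open>J (J q) = - q\<close>; the
      signs disagree, so it has to vanish.\<close>
    have "u \<bullet> J w + w \<bullet> J u = 0" using skew[of u w] by (simp add: inner_commute)
    then have "snd (sasaki_connection X Y p) = J (fst (sasaki_connection X Y p))"
      unfolding sasaki_connection_def h
      unfolding sasaki_christoffel_def u(1) w(1)
      unfolding pq J(3)[OF q]
      using lJ J(2) iJ
      by (simp add: linear_add linear_diff linear_scale algebra_simps)
    moreover have "fst (sasaki_connection X Y p) \<bullet> q = 0"
      using smooth_vector_field_sasaki_connection[OF X Y] Q
      unfolding smooth_vector_field_unit_tangent_bundle_iff pq by blast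
    ultimately show ?thesis
      unfolding pq TN[OF q] by (metis (mono_tags, lifting) mem_Collect_eq prod.collapse)
  qed
  then show ?thesis
    unfolding totally_geodesic_def totally_geodesic_submanifold_def
    using NM levi_civita_sasaki_connection by blast
qed

section \<open>Linear algebra of complex structures and normal operators\<close>

text \<open>Taking determinants in \<open>J^2 = -1\<close> makes \<open>(- 1) ^ CARD('k)\<close> a
  real square.\<close>

lemma complex_structure_even_dimension:
  fixes J :: "real ^ 'k \<Rightarrow> real ^ 'k"
  assumes "linear J" "\<And>x. J (J x) = - x"
  shows "even CARD('k)"
proof -
  have "J \<circ> J = (*\<^sub>R) (- 1)" using assms(2) by auto
  then have "det (matrix J) * det (matrix J) = (- 1) ^ CARD('k)"
    by (metis assms(1) det_matrix_scaleR det_mul matrix_compose)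
  moreover have "det (matrix J) * det (matrix J) \<ge> 0" by simp
  ultimately have "(- 1 :: real) ^ CARD('k) \<ge> 0" by metis
  then show ?thesis by (cases "even CARD('k)") auto
qed

text \<open>
  \<open>A\<^sup>tA\<close> restricted to the complement of \<open>\<xi>\<close> is non-negative with square \<open>(A\<^sup>t)\<^sup>2A\<^sup>2 = 1\<close>, hence equal to \<open>1\<close>.
\<close>

lemma normal_square_minus_one_imp_skew:
  fixes A B :: "'a::euclidean_space \<Rightarrow> 'a"
  assumes adj: "is_adjoint_on V A B" and normal: "\<And>x. x \<in> V \<Longrightarrow> B (A x) = A (B x)"
    and V: "subspace V" and AV: "\<And>x. x \<in> V \<Longrightarrow> A x \<in> V"
    and A: "linear A" and e: "e \<in> V" "A e = 0"
    and sq: "\<And>x. x \<in> V \<Longrightarrow> A (A x) = - x + (x \<bullet> e) *\<^sub>R e"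
    and x: "x \<in> V" and y: "y \<in> V"
  shows "A x \<bullet> y = - (x \<bullet> A y)" "A x \<bullet> A y = x \<bullet> y - (x \<bullet> e) * (y \<bullet> e)"
proof -
  have BV: "\<And>x. x \<in> V \<Longrightarrow> B x \<in> V" and AB: "\<And>x y. x \<in> V \<Longrightarrow> y \<in> V \<Longrightarrow> A x \<bullet> y = x \<bullet> B y"
    using adj by (auto simp: is_adjoint_on_def)
  have BA: "\<And>x y. x \<in> V \<Longrightarrow> y \<in> V \<Longrightarrow> B x \<bullet> y = x \<bullet> A y"
    using AB by (metis inner_commute)
  have eqI: "x = y" if "x \<in> V" "y \<in> V" "\<And>z. z \<in> V \<Longrightarrow> x \<bullet> z = y \<bullet> z" for x y
  proof -
    have "(x - y) \<bullet> (x - y) = 0"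
      using that(3)[OF subspace_diff[OF V that(1,2)]] by (simp add: inner_diff_left)
    then show ?thesis by simp
  qed
  have V0: "0 \<in> V" using V by (rule subspace_0)
  \<comment> \<open>Normality moves the kernel vector to the adjoint: the squared norm of
    \<open>B e\<close> is the product of \<open>A (B e) = B (A e) = 0\<close> with
    \<open>e\<close>.\<close>
  have Be: "B e = 0"
  proof -
    have "B e \<bullet> B e = A (B e) \<bullet> e" using AB[OF BV[OF e(1)] e(1)] by simp
    also have "\<dots> = B 0 \<bullet> e" using normal[OF e(1)] e(2) by simp
    also have "\<dots> = 0" using BA[OF V0 e(1)] by simp
    finally show ?thesis by simp
  qed
  have Ae: "A x \<bullet> e = 0" if "x \<in> V" for x using AB[OF that e(1)] Be by simp
  have BB: "B (B x) = - x + (x \<bullet> e) *\<^sub>R e" if x: "x \<in> V" for x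
  proof (rule eqI)
    show "B (B x) \<in> V" "- x + (x \<bullet> e) *\<^sub>R e \<in> V"
      by (intro BV subspace_add[OF V] subspace_neg[OF V] subspace_scale[OF V] x e(1))+
    show "B (B x) \<bullet> z = (- x + (x \<bullet> e) *\<^sub>R e) \<bullet> z" if z: "z \<in> V" for z
      using BA[OF BV[OF x] z] BA[OF x AV[OF z]]
      by (simp add: sq[OF z] inner_simps inner_commute[of e z])
  qed
  have BA_eq: "B (A x) = x - (x \<bullet> e) *\<^sub>R e" if x: "x \<in> V" for x
  proof -
    \<comment> \<open>\<open>m\<close> is \<open>A^t A x\<close>, and \<open>d\<close> is its
      deviation from the expected value, the projection of \<open>x\<close> off \<open>e\<close>.
      Since \<open>(A^t A)^2 x\<close> is that projection,
      \<open>A d \<bullet> A d = - (d \<bullet> d)\<close>, which forces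
      \<open>d = 0\<close>.\<close>
    define m where "m = B (A x)"
    define d where "d = m - (x - (x \<bullet> e) *\<^sub>R e)"
    have mV: "m \<in> V" and dV: "d \<in> V"
      unfolding d_def m_def
      by (intro AV BV subspace_diff[OF V] subspace_scale[OF V] x e(1))+
    have "B (A m) = B (B (A (A x)))"
      using normal[OF AV[OF x]] by (simp add: m_def)
    also have "\<dots> = - A (A x) + (A (A x) \<bullet> e) *\<^sub>R e" by (rule BB[OF AV[OF AV[OF x]]])
    also have "\<dots> = x - (x \<bullet> e) *\<^sub>R e" using Ae[OF AV[OF x]] by (simp add: sq[OF x])
    finally have BAm: "B (A m) = x - (x \<bullet> e) *\<^sub>R e" .
    have Ad: "A d = A m - A x"
      using A e(2) by (simp add: d_def linear_diff linear_scale)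
    have "A d \<bullet> A d = d \<bullet> B (A m) - d \<bullet> B (A x)"
      using AB[OF dV AV[OF mV]] AB[OF dV AV[OF x]] by (subst (2) Ad) (simp add: inner_diff_right)
    also have "\<dots> = - (d \<bullet> d)" unfolding BAm m_def[symmetric] by (simp add: d_def inner_diff_right)
    finally have "d \<bullet> d = 0" using inner_ge_zero[of "A d"] inner_ge_zero[of d] by linarith
    then show ?thesis by (simp add: d_def m_def)
  qed
  \<comment> \<open>Evaluate \<open>B (A (A x))\<close> twice: it is \<open>A x\<close> because
    \<open>B A\<close> is the identity off \<open>e\<close>, and \<open>- B x\<close> because of the
    formula for \<open>A^2\<close>.\<close>
  have Bx: "B x = - A x" if x: "x \<in> V" for x
  proof (rule eqI)
    show "B x \<in> V" "- A x \<in> V" by (intro BV AV subspace_neg[OF V] x)+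
    show "B x \<bullet> z = - A x \<bullet> z" if z: "z \<in> V" for z
    proof -
      have "B (A (A x)) \<bullet> z = A x \<bullet> z" using BA_eq[OF AV[OF x]] Ae[OF x] by simp
      moreover have "B (A (A x)) \<bullet> z = (- x + (x \<bullet> e) *\<^sub>R e) \<bullet> A z"
        using BA[OF AV[OF AV[OF x]] z] by (simp add: sq[OF x])
      moreover have "e \<bullet> A z = 0" using Ae[OF z] by (simp add: inner_commute)
      ultimately show ?thesis using BA[OF x z] by (simp add: inner_simps)
    qed
  qed
  show "A x \<bullet> y = - (x \<bullet> A y)" using AB[OF x y] Bx[OF y] by simp
  show "A x \<bullet> A y = x \<bullet> y - (x \<bullet> e) * (y \<bullet> e)"
    using AB[OF x AV[OF y]] BA_eq[OF y] by (simp add: inner_diff_right)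
qed

section \<open>Functions on the sphere with zero differential\<close>

text \<open>The radial projection \<open>r\<close> pulls \<open>f\<close> back to the punctured
  space, which is open and, in dimension at least 2, connected; there the ordinary constancy theorem
  applies.\<close>

lemma zero_derivative_sphere_constant:
  fixes f :: "'a::euclidean_space \<Rightarrow> 'b::real_normed_vector"
  assumes dim: "2 \<le> DIM('a)" and f: "smooth_map_on unit_sphere f"
    and 0: "\<And>q u. q \<in> unit_sphere \<Longrightarrow> u \<bullet> q = 0 \<Longrightarrow> diff_on unit_sphere f q u = 0"
    and p: "p \<in> unit_sphere" and q: "q \<in> unit_sphere"
  shows "f p = f q"
proof -
  define r where "r x = inverse (norm x) *\<^sub>R x" for x :: 'a
  have rS: "r x \<in> unit_sphere" if "x \<noteq> 0" for x using that by (simp add: r_def)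
  have "((\<lambda>x. f (r x)) has_derivative (\<lambda>h. 0)) (at x)" if x: "x \<in> - {0}" for x
  proof -
    have "(\<lambda>x. inverse (norm x) *\<^sub>R x) differentiable (at x)"
      using x by (intro differentiable_scaleR differentiable_inverse differentiable_norm_at differentiable_ident) auto
    then obtain L where L: "(r has_derivative L) (at x within - {0})"
      unfolding r_def[abs_def, symmetric] differentiable_def by (blast intro: has_derivative_at_withinI)
    have nb: "open (- {0::'a})" by auto
    have rr: "((\<lambda>x. r x \<bullet> r x) has_derivative (\<lambda>h. 0)) (at x within - {0})"
      by (rule has_derivative_transform[OF x _ has_derivative_const])
        (use rS in \<open>simp add: dot_square_norm\<close>)
    \<comment> \<open>Since \<open>r\<close> has constant norm, its derivative takes values tangent
      to the sphere at \<open>r x\<close>, where the differential of \<open>f\<close>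
      vanishes.\<close>
    have Lr: "L h \<bullet> r x = 0" for h
      using fun_cong[OF has_derivative_unique[OF
            has_derivative_inner[OF L L, unfolded at_within_open[OF x nb]]
            rr[unfolded at_within_open[OF x nb]]], of h]
      by (simp add: inner_commute)
    have "r ` (- {0}) \<subseteq> unit_sphere" "x \<noteq> 0" using rS x by blast+
    then have "(f has_derivative diff_on unit_sphere f (r x)) (at (r x) within r ` (- {0}))"
      using smooth_map_on_has_derivative[OF f rS] by (blast intro: has_derivative_subset)
    from diff_chain_within[OF L this]
    show ?thesis
      using 0[OF rS Lr] x unfolding at_within_open[OF x nb] by (simp add: o_def)
  qed
  moreover have "open (- {0::'a})" "p \<in> - {0}" "q \<in> - {0}" using p q by auto
  ultimately have "f (r p) = f (r q)"
    using has_derivative_zero_unique_connected[OF _ connected_punctured_universe[OF dim]] by blast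
  then show ?thesis using p q by (simp add: r_def)
qed

section \<open>Totally geodesic covariantly normal fields\<close>

lemma has_derivative_tangential:
  "((\<lambda>x. tangential x b) has_derivative (\<lambda>u. - (b \<bullet> u) *\<^sub>R q - (b \<bullet> q) *\<^sub>R u)) (at q within S)"
  unfolding tangential_def[abs_def]
  by (auto intro!: derivative_eq_intros simp: algebra_simps)

text \<open>These are the gradients of linear functions. If \<open>b\<close> is tangent at
  \<open>q\<close>, the field has value \<open>b\<close> there, so every tangent vector extends to a
  global field.\<close>

lemma smooth_vector_field_tangential: "smooth_vector_field unit_sphere (\<lambda>x. tangential x b)"
  unfolding smooth_vector_field_sphere_iff
  by (auto simp: tangential_inner)
    (auto simp: tangential_def intro!: smooth_map_intros)

text \<open>All values of \<open>A\<close> are orthogonal to \<open>\<xi>\<close> since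
  \<open>\<xi>\<close> has constant norm. Hence the squared norm of \<open>A \<xi>\<close> is the
  product of \<open>\<xi>\<close> with \<open>A^t A \<xi> = A A^t \<xi>\<close>, which is 0. The
  integral curves are thus great circles, and only the normal part \<open>- q\<close> of the
  Euclidean derivative remains.\<close>

lemma covariantly_normal_geodesic:
  assumes \<xi>: "unit_vector_field \<xi>" and "covariantly_normal \<xi>" and q: "q \<in> unit_sphere"
  shows "diff_on unit_sphere \<xi> q (\<xi> q) = - q"
proof -
  let ?V = "tangent_space unit_sphere q" and ?A = "shape_operator \<xi> q"
  obtain B where adj: "is_adjoint_on ?V ?A B" and normal: "\<And>X. X \<in> ?V \<Longrightarrow> B (?A X) = ?A (B X)"
    using assms(2) q unfolding covariantly_normal_def by blast
  have e: "\<xi> q \<in> ?V" "\<xi> q \<bullet> q = 0" "\<xi> q \<bullet> \<xi> q = 1"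
    using \<xi> q tangent_space_sphere[OF q]
    by (auto simp: unit_vector_field_def smooth_vector_field_sphere_iff dot_square_norm)
  have qq: "q \<bullet> q = 1" using q by (simp add: dot_square_norm)
  have A: "?A X = - (diff_on unit_sphere \<xi> q X + (X \<bullet> \<xi> q) *\<^sub>R q)" "?A X \<in> ?V" "?A X \<bullet> \<xi> q = 0"
    if "X \<in> ?V" for X
    using that diff_on_unit_vector_field[OF \<xi> q, of X] tangent_space_sphere[OF q] qq e(2)
    by (auto simp: shape_operator_def cov_deriv_def tangential_def inner_simps inner_commute)
  have B: "B (\<xi> q) \<in> ?V" using adj e(1) by (simp add: is_adjoint_on_def)
  have "?A (\<xi> q) \<bullet> ?A (\<xi> q) = \<xi> q \<bullet> B (?A (\<xi> q))"
    using adj e(1) A(2)[OF e(1)] unfolding is_adjoint_on_def by blast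
  also have "\<dots> = \<xi> q \<bullet> ?A (B (\<xi> q))" by (simp only: normal[OF e(1)])
  also have "\<dots> = 0" using A(3)[OF B] by (simp only: inner_commute)
  finally have "?A (\<xi> q) = 0" by simp
  then have "- (diff_on unit_sphere \<xi> q (\<xi> q) + (\<xi> q \<bullet> \<xi> q) *\<^sub>R q) = 0"
    by (simp only: A(1)[OF e(1)])
  then have "diff_on unit_sphere \<xi> q (\<xi> q) + (\<xi> q \<bullet> \<xi> q) *\<^sub>R q = 0"
    by (simp only: neg_equal_0_iff_equal)
  then show ?thesis by (simp add: e(3) eq_neg_iff_add_eq_0)
qed

text \<open>The equation for \<open>W = \<xi>\<close>. The argument of the outer
  \<open>d\<xi>\<close> is \<open>\<phi> u\<close>, which is orthogonal to \<open>\<xi>\<close>, so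
  the left side is \<open>\<phi> (\<phi> u)\<close>.\<close>

lemma totally_geodesic_square:
  fixes \<xi> :: "'a::euclidean_space \<Rightarrow> 'a"
  assumes \<xi>: "unit_vector_field \<xi>" and normal: "covariantly_normal \<xi>" and tg: "totally_geodesic \<xi>"
    and q: "q \<in> unit_sphere" and u: "u \<bullet> q = 0"
  shows "diff_on unit_sphere \<xi> q (diff_on unit_sphere \<xi> q u + (u \<bullet> \<xi> q) *\<^sub>R q) = - u + (u \<bullet> \<xi> q) *\<^sub>R \<xi> q"
proof -
  let ?d = "diff_on unit_sphere \<xi>" and ?e = "\<xi> q"
  have svf: "smooth_vector_field unit_sphere \<xi>" using \<xi> by (simp add: unit_vector_field_def)
  have s: "smooth_map_on unit_sphere \<xi>" using svf by (simp add: smooth_vector_field_def)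
  have lin: "linear (?d q)" using smooth_map_on_has_derivative[OF s q] by (rule has_derivative_linear)
  have e: "?e \<bullet> q = 0" "q \<bullet> ?e = 0" "?e \<bullet> ?e = 1" and qq: "q \<bullet> q = 1"
    using \<xi> q
    by (auto simp: unit_vector_field_def smooth_vector_field_sphere_iff dot_square_norm inner_commute)
  have u': "u \<in> tangent_space unit_sphere q" using u tangent_space_sphere[OF q] by simp
  have tu: "tangential q u = u" using u by (simp add: tangential_def)
  \<comment> \<open>Because \<open>d\<xi>(\<xi>) = - x\<close> holds at every point of the sphere,
    the second-derivative term of the equation becomes \<open>- u\<close>.\<close>
  have "((\<lambda>x. ?d x (\<xi> x)) has_derivative (\<lambda>h. - h)) (at q within unit_sphere)"
    using q covariantly_normal_geodesic[OF \<xi> normal]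
      has_derivative_minus[OF has_derivative_ident]
    by (rule has_derivative_transform)
  note G = diff_on_eqI[OF this u']
  note Z = diff_on_unit_vector_field[OF \<xi> q u]
  have ue: "u \<bullet> q = 0" "?e \<bullet> ?d q u = 0" "?d q u \<bullet> q = - (u \<bullet> ?e)"
    using Z u by (simp_all add: inner_commute)
  have \<Gamma>: "sasaki_christoffel (q, ?e) (u, ?d q u) (?e, - q)
      = ((- 1 / 2) *\<^sub>R (?d q u - (u \<bullet> ?e) *\<^sub>R q), (1 / 2) *\<^sub>R (u + (u \<bullet> ?e) *\<^sub>R ?e))"
    by (simp add: sasaki_christoffel_def ue qq e prod_eq_iff algebra_simps)
  have "- u + (1 / 2) *\<^sub>R (u + (u \<bullet> ?e) *\<^sub>R ?e)
      = ?d q (?d q u + (- 1 / 2) *\<^sub>R (?d q u - (u \<bullet> ?e) *\<^sub>R q))"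
    using totally_geodesic_equation[OF \<xi> tg smooth_vector_field_tangential[of u] svf q]
    unfolding tu G covariantly_normal_geodesic[OF \<xi> normal q] \<Gamma> by simp
  also have "?d q u + (- 1 / 2) *\<^sub>R (?d q u - (u \<bullet> ?e) *\<^sub>R q)
      = (1 / 2) *\<^sub>R (?d q u + (u \<bullet> ?e) *\<^sub>R q)"
    by (simp add: algebra_simps) (simp flip: scaleR_add_left)
  finally have "(1 / 2) *\<^sub>R ?d q (?d q u + (u \<bullet> ?e) *\<^sub>R q) = - u + (1 / 2) *\<^sub>R (u + (u \<bullet> ?e) *\<^sub>R ?e)"
    by (simp only: linear_scale[OF lin])
  from arg_cong[OF this, of "\<lambda>x. 2 *\<^sub>R x"] show ?thesis by (simp add: algebra_simps scaleR_2)
qed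

text \<open>The shape operator \<open>- \<phi>\<close> is normal with square \<open>-1\<close> off
  \<open>\<xi>\<close>, so it is skew and isometric there. Passing from \<open>\<phi>\<close> to
  \<open>d\<xi>\<close> adds a multiple of \<open>q\<close>, which supplies precisely the missing
  product \<open>(u \<bullet> \<xi> q) (w \<bullet> \<xi> q)\<close>.\<close>

lemma totally_geodesic_isometric:
  fixes \<xi> :: "'a::euclidean_space \<Rightarrow> 'a"
  assumes \<xi>: "unit_vector_field \<xi>" and normal: "covariantly_normal \<xi>" and tg: "totally_geodesic \<xi>"
    and q: "q \<in> unit_sphere" and u: "u \<bullet> q = 0" and w: "w \<bullet> q = 0"
  shows "diff_on unit_sphere \<xi> q u \<bullet> w = - (u \<bullet> diff_on unit_sphere \<xi> q w)"
    "diff_on unit_sphere \<xi> q u \<bullet> diff_on unit_sphere \<xi> q w = u \<bullet> w"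
proof -
  let ?V = "tangent_space unit_sphere q" and ?A = "shape_operator \<xi> q"
    and ?d = "diff_on unit_sphere \<xi> q" and ?e = "\<xi> q"
  obtain B where adj: "is_adjoint_on ?V ?A B" and B: "\<And>X. X \<in> ?V \<Longrightarrow> B (?A X) = ?A (B X)"
    using normal q unfolding covariantly_normal_def by blast
  have V: "?V = {v. v \<bullet> q = 0}" by (rule tangent_space_sphere[OF q])
  have qq: "q \<bullet> q = 1" using q by (simp add: dot_square_norm)
  have e: "?e \<in> ?V" "?e \<bullet> q = 0" "?e \<bullet> ?e = 1"
    using \<xi> q V
    by (auto simp: unit_vector_field_def smooth_vector_field_sphere_iff dot_square_norm)
  have s: "smooth_map_on unit_sphere \<xi>"
    using \<xi> by (simp add: unit_vector_field_def smooth_vector_field_def)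
  have lin: "linear ?d" using smooth_map_on_has_derivative[OF s q] by (rule has_derivative_linear)
  have A: "?A X = - (?d X + (X \<bullet> ?e) *\<^sub>R q)" "?A X \<bullet> q = 0" "?A X \<bullet> ?e = 0"
    if "X \<bullet> q = 0" for X
    using that diff_on_unit_vector_field[OF \<xi> q, of X] qq e(2)
    by (auto simp: shape_operator_def cov_deriv_def tangential_def inner_simps inner_commute)
  have linA: "linear ?A"
    using lin by (auto intro!: linearI simp: shape_operator_def cov_deriv_def tangential_def
        linear_add linear_scale inner_simps algebra_simps)
  have Ae: "?A ?e = 0"
    using A(1)[OF e(2)] covariantly_normal_geodesic[OF \<xi> normal q] e(3) by simp
  have sq: "?A (?A X) = - X + (X \<bullet> ?e) *\<^sub>R ?e" if X: "X \<in> ?V" for X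
  proof -
    have X: "X \<bullet> q = 0" using X V by simp
    have "?A (?A X) = - ?d (?A X)" using A(1)[OF A(2)[OF X]] A(3)[OF X] by simp
    also have "\<dots> = ?d (- ?A X)" by (rule linear_neg[OF lin, symmetric])
    also have "- ?A X = ?d X + (X \<bullet> ?e) *\<^sub>R q" by (simp add: A(1)[OF X])
    also have "?d (?d X + (X \<bullet> ?e) *\<^sub>R q) = - X + (X \<bullet> ?e) *\<^sub>R ?e"
      by (rule totally_geodesic_square[OF \<xi> normal tg q X])
    finally show ?thesis .
  qed
  have subV: "subspace ?V" unfolding V by (auto simp: subspace_def inner_simps)
  have AV: "\<And>X. X \<in> ?V \<Longrightarrow> ?A X \<in> ?V" using A(2) V by simp
  have uw: "u \<in> ?V" "w \<in> ?V" using u w V by auto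
  note * = normal_square_minus_one_imp_skew[OF adj B subV AV linA e(1) Ae sq uw]
  have "q \<bullet> w = 0" "u \<bullet> q = 0" using u w by (simp_all add: inner_commute)
  then show "?d u \<bullet> w = - (u \<bullet> ?d w)"
    using *(1) unfolding A(1)[OF u] A(1)[OF w] by (simp add: inner_simps)
  have "?d u \<bullet> q = - (u \<bullet> ?e)" "?d w \<bullet> q = - (w \<bullet> ?e)"
    using diff_on_unit_vector_field[OF \<xi> q] u w by auto
  then show "?d u \<bullet> ?d w = u \<bullet> w"
    using *(2) unfolding A(1)[OF u] A(1)[OF w]
    by (simp add: inner_simps inner_commute[of q "?d w"] qq)
qed

section \<open>Construction of the complex structure\<close>

text \<open>
  The linear extension of \<open>d\<xi>\<close> at \<open>q\<close> that sends the normal vector \<open>q\<close> to \<open>\<xi> q\<close>.  For a Hopf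
  field it is the complex structure at every point; conversely, the totally geodesic equation
  makes it independent of \<open>q\<close>.
\<close>

definition radial_extension :: "('a::euclidean_space \<Rightarrow> 'a) \<Rightarrow> 'a \<Rightarrow> 'a \<Rightarrow> 'a" where
  "radial_extension \<xi> b q = (b \<bullet> q) *\<^sub>R \<xi> q + diff_on unit_sphere \<xi> q (tangential q b)"

text \<open>By the product rule the derivative along \<open>u\<close> is
  \<open>(b \<bullet> q) d\<xi> u + (b \<bullet> u) \<xi> q\<close> plus the derivative of
  \<open>d\<xi>(W)\<close> for \<open>W\<close> the tangential part of \<open>b\<close>. The totally
  geodesic equation evaluates the last term, and the sum is 0.\<close>

lemma radial_extension_constant:
  fixes \<xi> :: "'a::euclidean_space \<Rightarrow> 'a"
  assumes dim: "2 \<le> DIM('a)"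
    and \<xi>: "unit_vector_field \<xi>" and normal: "covariantly_normal \<xi>" and tg: "totally_geodesic \<xi>"
    and p: "p \<in> unit_sphere" and q: "q \<in> unit_sphere"
  shows "radial_extension \<xi> b p = radial_extension \<xi> b q"
proof (rule zero_derivative_sphere_constant[OF dim _ _ p q])
  let ?d = "diff_on unit_sphere \<xi>" and ?W = "\<lambda>x. tangential x b"
  have s: "smooth_map_on unit_sphere \<xi>"
    using \<xi> by (simp add: unit_vector_field_def smooth_vector_field_def)
  have G: "smooth_map_on unit_sphere (\<lambda>x. ?d x (?W x))"
    by (rule smooth_map_on_diff_on[OF s smooth_vector_field_tangential])
  show "smooth_map_on unit_sphere (radial_extension \<xi> b)"
    unfolding radial_extension_def[abs_def] by (intro smooth_map_intros s G)
  fix q u :: 'a assume q: "q \<in> unit_sphere" and u: "u \<bullet> q = 0"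
  define w where "w = tangential q b"
  define e where "e = \<xi> q"
  have qq: "q \<bullet> q = 1" using q by (simp add: dot_square_norm)
  have e: "e \<bullet> q = 0" using \<xi> q
    by (auto simp: e_def unit_vector_field_def smooth_vector_field_sphere_iff)
  have w: "w \<bullet> q = 0" and uw: "u \<bullet> w = u \<bullet> b"
    using q u by (simp_all add: w_def tangential_inner)
  have u': "u \<in> tangent_space unit_sphere q" using u tangent_space_sphere[OF q] by simp
  have tu: "tangential q u = u" using u by (simp add: tangential_def)
  have lin: "linear (?d q)" using smooth_map_on_has_derivative[OF s q] by (rule has_derivative_linear)
  define Z where "Z = ?d q u"
  define Z' where "Z' = ?d q w"
  have Zq: "Z \<bullet> q = - (u \<bullet> e)" "Z' \<bullet> q = - (w \<bullet> e)"
    using diff_on_unit_vector_field(2)[OF \<xi> q] u w by (simp_all add: Z_def Z'_def e_def)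
  have Z: "u \<bullet> Z' + w \<bullet> Z = 0" "Z \<bullet> Z' = u \<bullet> w"
    using totally_geodesic_isometric[OF \<xi> normal tg q u w]
    by (simp_all add: Z_def Z'_def inner_commute)
  \<comment> \<open>\<open>Y\<close> and \<open>Y'\<close> are \<open>\<phi> u\<close> and
    \<open>\<phi> w\<close>, the vectors on which \<open>d\<xi>\<close> is already known.\<close>
  define Y where "Y = Z + (u \<bullet> e) *\<^sub>R q"
  define Y' where "Y' = Z' + (w \<bullet> e) *\<^sub>R q"
  have sq: "?d q Y = - u + (u \<bullet> e) *\<^sub>R e" "?d q Y' = - w + (w \<bullet> e) *\<^sub>R e"
    using totally_geodesic_square[OF \<xi> normal tg q] u w
    by (simp_all add: Y_def Y'_def Z_def Z'_def e_def)
  \<comment> \<open>Skewness removes the mixed coefficient, and the isometry property turns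
    \<open>Z \<bullet> Z'\<close> into \<open>u \<bullet> w\<close>, which equals
    \<open>u \<bullet> b\<close>.\<close>
  have \<Gamma>: "sasaki_christoffel (q, e) (u, Z) (w, Z')
      = ((- 1 / 2) *\<^sub>R ((w \<bullet> e) *\<^sub>R Z + (u \<bullet> e) *\<^sub>R Z') + (u \<bullet> b - (u \<bullet> e) * (w \<bullet> e)) *\<^sub>R q,
         (1 / 2) *\<^sub>R ((w \<bullet> e) *\<^sub>R u + (u \<bullet> e) *\<^sub>R w) + (u \<bullet> b - (u \<bullet> e) * (w \<bullet> e)) *\<^sub>R e)"
    unfolding sasaki_christoffel_def fst_conv snd_conv Z Zq uw
    by (simp add: algebra_simps)
  have dW: "diff_on unit_sphere ?W q u = - (b \<bullet> u) *\<^sub>R q - (b \<bullet> q) *\<^sub>R u"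
    by (rule diff_on_eqI[OF has_derivative_tangential u'])
  \<comment> \<open>Written through \<open>u\<close>, \<open>Y\<close> and \<open>Y'\<close> the
    argument has no separate multiple of \<open>q\<close>: those from the field, from the
    Christoffel form and from \<open>Y\<close>, \<open>Y'\<close> cancel.\<close>
  let ?R = "- (b \<bullet> q) *\<^sub>R u + ((- 1 / 2) * (w \<bullet> e)) *\<^sub>R Y
        + ((- 1 / 2) * (u \<bullet> e)) *\<^sub>R Y'"
  have "diff_on unit_sphere ?W q u + fst (sasaki_christoffel (q, e) (u, Z) (w, Z')) = ?R"
    unfolding dW \<Gamma> Y_def Y'_def
    by (simp add: algebra_simps inner_commute[of b u]) (simp flip: scaleR_add_left)
  then have "diff_on unit_sphere (\<lambda>x. ?d x (?W x)) q u + snd (sasaki_christoffel (q, e) (u, Z) (w, Z')) = ?d q ?R"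
    using totally_geodesic_equation[OF \<xi> tg smooth_vector_field_tangential[of u] smooth_vector_field_tangential[of b] q]
    unfolding tu w_def[symmetric] e_def[symmetric] Z_def[symmetric] Z'_def[symmetric] by simp
  also have "?d q ?R = - (b \<bullet> q) *\<^sub>R Z + ((- 1 / 2) * (w \<bullet> e)) *\<^sub>R (- u + (u \<bullet> e) *\<^sub>R e)
        + ((- 1 / 2) * (u \<bullet> e)) *\<^sub>R (- w + (w \<bullet> e) *\<^sub>R e)"
    by (simp only: linear_add[OF lin] linear_scale[OF lin] sq Z_def[symmetric])
  also have "\<dots> = - (b \<bullet> q) *\<^sub>R Z + (1 / 2) *\<^sub>R ((w \<bullet> e) *\<^sub>R u + (u \<bullet> e) *\<^sub>R w)
        - ((u \<bullet> e) * (w \<bullet> e)) *\<^sub>R e"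
    by (simp add: algebra_simps) (simp flip: scaleR_add_left)
  finally have dG: "diff_on unit_sphere (\<lambda>x. ?d x (?W x)) q u = - (b \<bullet> q) *\<^sub>R Z - (u \<bullet> b) *\<^sub>R e"
    unfolding \<Gamma> snd_conv by (simp add: algebra_simps eq_neg_iff_add_eq_0)
  have "(radial_extension \<xi> b has_derivative
      (\<lambda>h. (b \<bullet> q) *\<^sub>R ?d q h + (b \<bullet> h) *\<^sub>R \<xi> q + diff_on unit_sphere (\<lambda>x. ?d x (?W x)) q h))
      (at q within unit_sphere)"
    unfolding radial_extension_def[abs_def]
    by (intro has_derivative_add has_derivative_scaleR has_derivative_inner_right has_derivative_ident
        smooth_map_on_has_derivative s G q)
  from diff_on_eqI[OF this u'] show "diff_on unit_sphere (radial_extension \<xi> b) q u = 0"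
    by (simp add: dG Z_def e_def inner_commute)
qed

text \<open>\<open>J\<close> may be computed at any base point, so at a unit vector \<open>q\<close>
  the base point \<open>q\<close> itself is chosen: there \<open>J q = \<xi> q\<close> and
  \<open>J (\<xi> q) = d\<xi>(\<xi> q) = - q\<close>. Homogeneity extends both norm and square to
  all vectors.\<close>

lemma totally_geodesic_imp_hopf:
  fixes \<xi> :: "'a::euclidean_space \<Rightarrow> 'a"
  assumes dim: "2 \<le> DIM('a)"
    and \<xi>: "unit_vector_field \<xi>" and normal: "covariantly_normal \<xi>" and tg: "totally_geodesic \<xi>"
  shows "hopf_vector_field \<xi>"
proof -
  obtain p :: 'a where p: "p \<in> unit_sphere" using vector_choose_size[of 1] by auto
  define J where "J b = radial_extension \<xi> b p" for b
  have s: "smooth_map_on unit_sphere \<xi>"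
    using \<xi> by (simp add: unit_vector_field_def smooth_vector_field_def)
  have J: "J b = radial_extension \<xi> b q" if "q \<in> unit_sphere" for b q
    unfolding J_def by (rule radial_extension_constant[OF dim \<xi> normal tg p that])
  have "linear (diff_on unit_sphere \<xi> p)"
    using smooth_map_on_has_derivative[OF s p] by (rule has_derivative_linear)
  moreover have "tangential p (x + y) = tangential p x + tangential p y"
    "tangential p (c *\<^sub>R x) = c *\<^sub>R tangential p x" for x y c
    by (simp_all add: tangential_def inner_simps algebra_simps)
  ultimately have lJ: "linear J"
    by (auto intro!: linearI simp: J_def radial_extension_def linear_add linear_scale inner_simps algebra_simps)
  have J\<xi>: "J q = \<xi> q" if q: "q \<in> unit_sphere" for q
  proof -
    have "linear (diff_on unit_sphere \<xi> q)"
      using smooth_map_on_has_derivative[OF s q] by (rule has_derivative_linear)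
    then show ?thesis
      using q by (simp add: J[OF q] radial_extension_def tangential_def dot_square_norm linear_0)
  qed
  have J2: "J (\<xi> q) = - q" if q: "q \<in> unit_sphere" for q
  proof -
    have "\<xi> q \<bullet> q = 0" using \<xi> q by (simp add: unit_vector_field_def smooth_vector_field_sphere_iff)
    then show ?thesis
      by (simp add: J[OF q] radial_extension_def tangential_def covariantly_normal_geodesic[OF \<xi> normal q])
  qed
  have polar: "\<exists>q\<in>unit_sphere. x = norm x *\<^sub>R q" for x :: 'a
  proof (cases "x = 0")
    case True
    then show ?thesis using p by auto
  next
    case False
    then show ?thesis by (intro bexI[of _ "inverse (norm x) *\<^sub>R x"]) auto
  qed
  have "norm (J x) = norm x" for x
  proof -
    obtain q where q: "q \<in> unit_sphere" and x: "x = norm x *\<^sub>R q" using polar by blast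
    have "norm (J (norm x *\<^sub>R q)) = norm x"
      using \<xi> q by (simp add: linear_scale[OF lJ] J\<xi>[OF q] unit_vector_field_def)
    with x show ?thesis by simp
  qed
  then have "orthogonal_transformation J" using lJ by (simp add: orthogonal_transformation)
  moreover have "J (J x) = - x" for x
  proof -
    obtain q where q: "q \<in> unit_sphere" and x: "x = norm x *\<^sub>R q" using polar by blast
    have "J (J (norm x *\<^sub>R q)) = - (norm x *\<^sub>R q)"
      by (simp add: linear_scale[OF lJ] J\<xi>[OF q] J2[OF q])
    with x show ?thesis by simp
  qed
  ultimately show ?thesis unfolding hopf_vector_field_def using J\<xi> by auto
qed

theorem theorem3p1:
  fixes \<xi> :: "real ^ 'k \<Rightarrow> real ^ 'k" and n :: nat
  assumes "CARD('k) = n + 2"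
    and "unit_vector_field \<xi>"
    and "covariantly_normal \<xi>"
  shows "totally_geodesic \<xi> \<longleftrightarrow> (\<exists>m::nat. n = 2 * m) \<and> hopf_vector_field \<xi>"
proof
  assume "totally_geodesic \<xi>"
  then have hopf: "hopf_vector_field \<xi>"
    using assms by (intro totally_geodesic_imp_hopf) simp_all
  \<comment> \<open>The complex structure lives on the ambient space, whose dimension is
    \<open>n + 2\<close>, so its parity is that of \<open>n\<close>.\<close>
  then have "even CARD('k)"
    unfolding hopf_vector_field_def orthogonal_transformation
    by (blast intro: complex_structure_even_dimension)
  then show "(\<exists>m::nat. n = 2 * m) \<and> hopf_vector_field \<xi>"
    using hopf assms(1) by (auto elim: evenE)
next
  assume "(\<exists>m::nat. n = 2 * m) \<and> hopf_vector_field \<xi>"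
  then show "totally_geodesic \<xi>"
    using hopf_imp_totally_geodesic[OF assms(2)] by blast
qed

end
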